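(* Every language $A\in\mathrm{P}$ whose census function is computable in polynomial time is rankable if and only if $\mathrm{P}=\mathrm{PP}$.
   Context: Strings are over $\Sigma=\{0,1\}$, with $\le$ the standard lexicographic order on $\Sigma^*$. The census function of $A$ is $\mathrm{census}_A(1^n)=|\{x\in A:|x|=n\}|$. The ranking function of $A$ maps $x$ to $|\{y\le x: y\in A\}|$; $A$ is rankable if its ranking function is polynomial-time computable. PP is probabilistic polynomial time (languages $L$ with $A\in\mathrm{P}$, polynomial $p$ such that $x\in L\iff|\{y:|y|=p(|x|),\langle x,y\rangle\in A\}|\ge 2^{p(|x|)-1}$). *)

theory Defs
  imports "HOL-Computational_Algebra.Polynomial"
begin

section \<open>Multi-tape Turing machines\<close>

type_synonym symbol = nat

definition blank :: symbol where
  "blank = 0"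

definition bit_symbol :: "bool \<Rightarrow> symbol" where
  "bit_symbol b = (if b then 2 else 1)"

text \<open>
  Tapes are infinite in both directions. The cells are numbered relative to the head, which is
  therefore always at cell 0, and a head movement renumbers the cells.
\<close>

type_synonym tape = "int \<Rightarrow> symbol"

datatype move = Move_Left | Stay | Move_Right

fun move_head :: "move \<Rightarrow> tape \<Rightarrow> tape" where
  "move_head Move_Left t = (\<lambda>i. t (i - 1))"
| "move_head Stay t = t"
| "move_head Move_Right t = (\<lambda>i. t (i + 1))"

definition act :: "symbol \<times> move \<Rightarrow> tape \<Rightarrow> tape" where
  "act = (\<lambda>(s, d) t. move_head d (t(0 := s)))"

text \<open>
  States are the numbers below \<open>states\<close>, tape symbols the numbers below \<open>symbols\<close>. Given a state
  and the list of scanned symbols (one per tape), \<open>delta\<close> yields the next state and, for each tape,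
  the symbol to write and the subsequent head movement.
\<close>

record tm =
  tapes :: nat
  symbols :: nat
  states :: nat
  start :: nat
  accept :: nat
  reject :: nat
  delta :: "nat \<Rightarrow> symbol list \<Rightarrow> nat \<times> (symbol \<times> move) list"

text \<open>The bound 3 leaves room for the blank and the two bits.\<close>

definition wf_tm :: "tm \<Rightarrow> bool" where
  "wf_tm M \<longleftrightarrow>
     1 \<le> tapes M \<and> 3 \<le> symbols M \<and>
     start M < states M \<and> accept M < states M \<and> reject M < states M \<and> accept M \<noteq> reject M \<and>
     (\<forall>q rs. q < states M \<and> length rs = tapes M \<and> set rs \<subseteq> {..<symbols M} \<longrightarrow>
        (case delta M q rs of (q', acts) \<Rightarrow>
           q' < states M \<and> length acts = tapes M \<and> fst ` set acts \<subseteq> {..<symbols M}))"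

type_synonym config = "nat \<times> tape list"

definition halted :: "tm \<Rightarrow> config \<Rightarrow> bool" where
  "halted M c \<longleftrightarrow> fst c = accept M \<or> fst c = reject M"

definition step :: "tm \<Rightarrow> config \<Rightarrow> config" where
  "step M c =
     (if halted M c then c
      else case delta M (fst c) (map (\<lambda>t. t 0) (snd c)) of
        (q', acts) \<Rightarrow> (q', map2 act acts (snd c)))"

text \<open>The tape containing just the string \<open>x\<close>, with the head on its first symbol.\<close>

definition string_tape :: "bool list \<Rightarrow> tape" where
  "string_tape x i = (if 0 \<le> i \<and> i < int (length x) then bit_symbol (x ! nat i) else blank)"

definition initial :: "tm \<Rightarrow> bool list \<Rightarrow> config" where
  "initial M x = (start M, string_tape x # replicate (tapes M - 1) (\<lambda>_. blank))"


section \<open>Polynomial time\<close>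

definition decides_in_time :: "tm \<Rightarrow> bool list set \<Rightarrow> (nat \<Rightarrow> nat) \<Rightarrow> bool" where
  "decides_in_time M A T \<longleftrightarrow>
     (\<forall>x. \<exists>t \<le> T (length x).
        fst ((step M ^^ t) (initial M x)) = (if x \<in> A then accept M else reject M))"

text \<open>
  The first tape serves both as input and as output tape. Nothing is required of the machine on
  inputs outside the domain \<open>D\<close>.
\<close>

definition computes_in_time ::
  "tm \<Rightarrow> bool list set \<Rightarrow> (bool list \<Rightarrow> bool list) \<Rightarrow> (nat \<Rightarrow> nat) \<Rightarrow> bool" where
  "computes_in_time M D f T \<longleftrightarrow>
     (\<forall>x \<in> D. \<exists>t \<le> T (length x).
        let c = (step M ^^ t) (initial M x)
        in halted M c \<and> hd (snd c) = string_tape (f x))"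

definition polytime_computable_on :: "bool list set \<Rightarrow> (bool list \<Rightarrow> bool list) \<Rightarrow> bool" where
  "polytime_computable_on D f \<longleftrightarrow>
     (\<exists>M (p :: nat poly). wf_tm M \<and> computes_in_time M D f (poly p))"

definition class_P :: "bool list set set" where
  "class_P = {A. \<exists>M (p :: nat poly). wf_tm M \<and> decides_in_time M A (poly p)}"

text \<open>The injective pairing that maps \<open>x\<^sub>1\<dots>x\<^sub>n\<close> and \<open>y\<close> to \<open>1x\<^sub>1\<dots>1x\<^sub>n0y\<close>.\<close>

definition string_pair :: "bool list \<Rightarrow> bool list \<Rightarrow> bool list" where
  "string_pair x y = concat (map (\<lambda>b. [True, b]) x) @ False # y"

text \<open>
  If \<open>poly p (length x) = 0\<close>, the truncated exponent gives the threshold 1 instead of 1/2, which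
  makes no difference for an integer count.
\<close>

definition class_PP :: "bool list set set" where
  "class_PP = {L. \<exists>A \<in> class_P. \<exists>p :: nat poly. \<forall>x.
     x \<in> L \<longleftrightarrow>
       card {y. length y = poly p (length x) \<and> string_pair x y \<in> A}
         \<ge> 2 ^ (poly p (length x) - 1)}"


section \<open>Census and ranking\<close>

text \<open>Binary notation, most significant bit first, without leading zeros.\<close>

fun binary :: "nat \<Rightarrow> bool list" where
  "binary n = (if n < 2 then [n = 1] else binary (n div 2) @ [odd n])"

declare binary.simps [simp del]

text \<open>
  The standard lexicographic order on \<open>\<Sigma>\<^sup>*\<close> compares lengths first, so that every string has only
  finitely many predecessors.
\<close>

definition lex_le :: "bool list \<Rightarrow> bool list \<Rightarrow> bool" where
  "lex_le y x \<longleftrightarrow> y = x \<or> (y, x) \<in> lenlex {(a, b). a < b}"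

lemma finite_lex_le: "finite {y. lex_le y x}"
proof (rule finite_subset)
  show "{y. lex_le y x} \<subseteq> {y. set y \<subseteq> UNIV \<and> length y \<le> length x}"
    by (auto simp: lex_le_def dest: lenlex_length)
qed (rule finite_lists_length_le, simp)

definition census :: "bool list set \<Rightarrow> nat \<Rightarrow> nat" where
  "census A n = card {x \<in> A. length x = n}"

definition polytime_census :: "bool list set \<Rightarrow> bool" where
  "polytime_census A \<longleftrightarrow>
     polytime_computable_on (range (\<lambda>n. replicate n True)) (\<lambda>s. binary (census A (length s)))"

definition ranking :: "bool list set \<Rightarrow> bool list \<Rightarrow> nat" where
  "ranking A x = card {y. lex_le y x \<and> y \<in> A}"

definition rankable :: "bool list set \<Rightarrow> bool" where
  "rankable A \<longleftrightarrow> polytime_computable_on UNIV (\<lambda>x. binary (ranking A x))"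

end

theory Submission
  imports Defs
begin

text \<open>
  If PP = P, the set of all pairs \<open>\<langle>1x, k\<rangle>\<close> with \<open>k \<le> ranking A x\<close> is decidable in polynomial time,
  since it is in PP: take \<open>2^m - k\<close> trivial witnesses together with one witness for every \<open>y \<le> x\<close>
  in \<open>A\<close>, and compare with \<open>2^m\<close>, half of the number of candidates. Binary search then gives the
  rank.

  Conversely, let \<open>A\<close> and \<open>p\<close> witness that \<open>L\<close> is in PP. Put \<open>\<langle>x, 0y\<rangle>\<close> into \<open>B\<close> iff \<open>\<langle>x, y\<rangle>\<close> is in
  \<open>A\<close>, and \<open>\<langle>x, 1y\<rangle>\<close> iff it is not. Flipping the bit after the separator exchanges \<open>B\<close> and its
  complement, so that exactly half of the strings of each positive length are in \<open>B\<close>, and likewise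
  half of the nonempty strings before \<open>\<langle>x, 00\<dots>0\<rangle>\<close>. Hence the rank of \<open>\<langle>x, 01\<dots>1\<rangle>\<close> is a known number,
  divisible by \<open>2^p(n)\<close> for \<open>n = |x|\<close>, plus the number of witnesses for \<open>x\<close>, and two bits of it
  tell whether \<open>x\<close> is in \<open>L\<close>.
\<close>

text \<open>The converse may rank only sets with an easy census, and a rank in \<open>A\<close>
  itself would mix the witnesses for \<open>x\<close> with an unknown number of earlier elements.
  Balancing removes both obstacles at once. The involution must respect initial segments: if a
  string of the same length precedes <x, 00...0>, the first difference lies within the coding of x,
  and the bit to be flipped comes later. The strings <x, 0y> with |y| = p(n) are consecutive because
  the pairing puts y behind x.

  Both directions count strings through the numbers \<open>val (True # x)\<close>, which enumerate
  all strings by the positive integers in length-lexicographic order. This is why the query contains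
  1x instead of x, and it turns counts of strings into sizes of integer intervals.

  Time is measured on concrete multi-tape machines. Hence the arguments rest on a class of
  \<open>feasible\<close> functions that is closed under calls of polynomial-time machines and under
  a fold with bounded growth, and whose programs are compiled to machines once and for all.\<close>

section \<open>Structured programs and their compilation\<close>

text \<open>A program is its own program counter: a step rewrites it to what is left to be done. The
  first number in \<open>Run\<close> is the current state of the embedded machine and the second one
  its first tape, so that a machine in the middle of its run is again a program. The two programs
  after it are the continuations for acceptance and rejection.\<close>

datatype prog =
    is_Halt: Halt bool
  | Act nat "symbol \<Rightarrow> symbol \<times> move"
  | Seq prog prog
  | Branch nat "symbol \<Rightarrow> bool" prog prog
  | Loop nat "symbol \<Rightarrow> bool" prog
  | Run tm nat nat prog prog

definition idle :: "(nat \<Rightarrow> symbol) \<Rightarrow> nat \<Rightarrow> symbol \<times> move" where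
  "idle rs i = (rs i, Stay)"

text \<open>In \<open>Run\<close>, \<open>wf_tm\<close> constrains \<open>delta\<close> only on the
  machine's own alphabet, whereas the tapes may hold symbols of another embedded machine. On such a
  symbol the program idles forever, which keeps the compiled machine well formed.\<close>

fun transition :: "prog \<Rightarrow> (nat \<Rightarrow> symbol) \<Rightarrow> prog \<times> (nat \<Rightarrow> symbol \<times> move)" where
  "transition (Halt b) rs = (Halt b, idle rs)"
| "transition (Act i f) rs = (Halt True, (idle rs)(i := f (rs i)))"
| "transition (Seq c d) rs =
     (if is_Halt c then (d, idle rs) else (Seq (fst (transition c rs)) d, snd (transition c rs)))"
| "transition (Branch i P c d) rs = (if P (rs i) then c else d, idle rs)"
| "transition (Loop i P c) rs = (if P (rs i) then Seq c (Loop i P c) else Halt True, idle rs)"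
| "transition (Run M q n c d) rs =
     (if q = accept M then (c, idle rs)
      else if q = reject M then (d, idle rs)
      else let rl = map rs [n..<n + tapes M] in
        if set rl \<subseteq> {..<symbols M}
        then (Run M (fst (delta M q rl)) n c d,
              \<lambda>i. if n \<le> i \<and> i < n + tapes M then snd (delta M q rl) ! (i - n) else idle rs i)
        else (Run M q n c d, idle rs))"

text \<open>An over-approximation of the programs reachable by \<open>transition\<close>. It is
  finite although loops unfold without end, since every unfolding has the form
  \<open>Seq c' (Loop i P c)\<close>.\<close>

fun residuals :: "prog \<Rightarrow> prog set" where
  "residuals (Halt b) = {Halt b}"
| "residuals (Act i f) = {Act i f, Halt True}"
| "residuals (Seq c d) = (\<lambda>c'. Seq c' d) ` residuals c \<union> residuals d"
| "residuals (Branch i P c d) = {Branch i P c d} \<union> residuals c \<union> residuals d"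
| "residuals (Loop i P c) = {Loop i P c, Halt True} \<union> (\<lambda>c'. Seq c' (Loop i P c)) ` residuals c"
| "residuals (Run M q n c d) =
     (\<lambda>q'. Run M q' n c d) ` {..<states M} \<union> residuals c \<union> residuals d"

text \<open>Besides the blank and the bits, the scanned symbol itself may be written back. Such an
  action respects every alphabet with at least three symbols, whatever the tape holds.\<close>

definition small_writes :: "(symbol \<Rightarrow> symbol \<times> move) \<Rightarrow> bool" where
  "small_writes f \<longleftrightarrow> (\<forall>s. fst (f s) = s \<or> fst (f s) < 3)"

fun ok :: "prog \<Rightarrow> bool" where
  "ok (Halt b) \<longleftrightarrow> True"
| "ok (Act i f) \<longleftrightarrow> small_writes f"
| "ok (Seq c d) \<longleftrightarrow> ok c \<and> ok d"
| "ok (Branch i P c d) \<longleftrightarrow> ok c \<and> ok d"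
| "ok (Loop i P c) \<longleftrightarrow> ok c"
| "ok (Run M q n c d) \<longleftrightarrow> wf_tm M \<and> q < states M \<and> ok c \<and> ok d"

fun tapes_bound :: "prog \<Rightarrow> nat" where
  "tapes_bound (Halt b) = 1"
| "tapes_bound (Act i f) = Suc i"
| "tapes_bound (Seq c d) = max (tapes_bound c) (tapes_bound d)"
| "tapes_bound (Branch i P c d) = max (Suc i) (max (tapes_bound c) (tapes_bound d))"
| "tapes_bound (Loop i P c) = max (Suc i) (tapes_bound c)"
| "tapes_bound (Run M q n c d) = max (n + tapes M) (max (tapes_bound c) (tapes_bound d))"

fun symbols_bound :: "prog \<Rightarrow> nat" where
  "symbols_bound (Halt b) = 3"
| "symbols_bound (Act i f) = 3"
| "symbols_bound (Seq c d) = max (symbols_bound c) (symbols_bound d)"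
| "symbols_bound (Branch i P c d) = max (symbols_bound c) (symbols_bound d)"
| "symbols_bound (Loop i P c) = symbols_bound c"
| "symbols_bound (Run M q n c d) = max (symbols M) (max (symbols_bound c) (symbols_bound d))"

lemma three_le_symbols_bound: "3 \<le> symbols_bound c"
  by (induction c) auto

lemma one_le_tapes_bound: "1 \<le> tapes_bound c"
  by (induction c) auto

lemma finite_residuals: "finite (residuals c)"
  by (induction c) auto

lemma self_in_residuals: "ok c \<Longrightarrow> c \<in> residuals c"
  by (induction c) auto

lemma wf_tm_delta:
  assumes "wf_tm M" "q < states M" "length rs = tapes M" "set rs \<subseteq> {..<symbols M}"
  shows "fst (delta M q rs) < states M" "length (snd (delta M q rs)) = tapes M"
    "fst ` set (snd (delta M q rs)) \<subseteq> {..<symbols M}"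
  using assms unfolding wf_tm_def case_prod_beta by blast+

lemma transition_in_residuals:
  "ok c \<Longrightarrow> d \<in> residuals c \<Longrightarrow> fst (transition d rs) \<in> residuals c"
proof (induction c arbitrary: d)
  case (Seq c1 c2)
  from Seq.prems(2) consider c' where "c' \<in> residuals c1" "d = Seq c' c2" | "d \<in> residuals c2" by auto
  then show ?case
  proof cases
    case 1
    then show ?thesis
      using Seq.IH(1)[of c'] Seq.prems self_in_residuals[of c2]
      by auto
  next
    case 2
    then show ?thesis using Seq.IH(2)[of d] Seq.prems by auto
  qed
next
  case (Branch i P c1 c2)
  from Branch.prems(2) consider "d = Branch i P c1 c2" | "d \<in> residuals c1" | "d \<in> residuals c2" by auto
  then show ?case
    using Branch.IH(1)[of d] Branch.IH(2)[of d] Branch.prems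
      self_in_residuals[of c1] self_in_residuals[of c2] by cases auto
next
  case (Loop i P c)
  from Loop.prems(2) consider "d = Loop i P c" | "d = Halt True"
    | c' where "c' \<in> residuals c" "d = Seq c' (Loop i P c)" by auto
  then show ?case
  proof cases
    case 3
    then show ?thesis
      using Loop.IH[of c'] Loop.prems
      by auto
  qed (use Loop.prems self_in_residuals[of c] in auto)
next
  case (Run M q n c1 c2)
  from Run.prems(2) consider q' where "q' < states M" "d = Run M q' n c1 c2"
    | "d \<in> residuals c1" | "d \<in> residuals c2" by auto
  then show ?case
  proof cases
    case 1
    have "fst (delta M q' (map rs [n..<n + tapes M])) < states M"
      if "set (map rs [n..<n + tapes M]) \<subseteq> {..<symbols M}"
      using that 1 Run.prems by (intro wf_tm_delta) auto
    then show ?thesis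
      using 1 Run.prems self_in_residuals[of c1] self_in_residuals[of c2]
      by (simp add: Let_def)
  next
    case 2
    then show ?thesis using Run.IH(1)[of d] Run.prems by auto
  next
    case 3
    then show ?thesis using Run.IH(2)[of d] Run.prems by auto
  qed
qed auto

lemma residuals_ok:
  "ok c \<Longrightarrow> d \<in> residuals c \<Longrightarrow>
    ok d \<and> tapes_bound d \<le> tapes_bound c \<and> symbols_bound d \<le> symbols_bound c"
proof (induction c arbitrary: d)
  case (Seq c1 c2)
  from Seq.prems(2) consider c' where "c' \<in> residuals c1" "d = Seq c' c2" | "d \<in> residuals c2" by auto
  then show ?case
  proof cases
    case 1
    with Seq.IH(1)[of c'] Seq.prems show ?thesis by auto
  next
    case 2
    with Seq.IH(2)[of d] Seq.prems show ?thesis by auto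
  qed
next
  case (Branch i P c1 c2)
  from Branch.prems(2) consider "d = Branch i P c1 c2" | "d \<in> residuals c1" | "d \<in> residuals c2" by auto
  then show ?case
    using Branch.IH(1)[of d] Branch.IH(2)[of d] Branch.prems by cases auto
next
  case (Loop i P c)
  from Loop.prems(2) consider "d = Loop i P c" | "d = Halt True"
    | c' where "c' \<in> residuals c" "d = Seq c' (Loop i P c)" by auto
  then show ?case
  proof cases
    case 3
    with Loop.IH[of c'] Loop.prems show ?thesis by auto
  qed (use Loop.prems in \<open>auto simp: three_le_symbols_bound\<close>)
next
  case (Run M q n c1 c2)
  from Run.prems(2) consider q' where "q' < states M" "d = Run M q' n c1 c2"
    | "d \<in> residuals c1" | "d \<in> residuals c2" by auto
  then show ?case
    using Run.IH(1)[of d] Run.IH(2)[of d] Run.prems by cases auto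
qed auto

text \<open>Programs run on infinitely many tapes, so that scratch tapes can be chosen freely. This
  lemma lets the compiled machine get by with finitely many.\<close>

lemma transition_idle_outside:
  "tapes_bound c \<le> i \<Longrightarrow> snd (transition c rs) i = (rs i, Stay)"
  by (induction c) (auto simp: idle_def Let_def)

lemma transition_symbol_less:
  assumes "ok c" "symbols_bound c \<le> S" "\<And>i. rs i < S"
  shows "fst (snd (transition c rs) i) < S"
  using assms
proof (induction c)
  case (Act j f)
  then have "fst (f (rs j)) < S"
    unfolding small_writes_def ok.simps symbols_bound.simps by (metis less_le_trans)
  with Act(3) show ?case by (simp add: idle_def)
next
  case (Run M q n c d)
  have "fst (snd (delta M q (map rs [n..<n + tapes M])) ! (i - n)) < S"
    if "map rs [n..<n + tapes M] = rl" "set rl \<subseteq> {..<symbols M}" "n \<le> i" "i < n + tapes M" for rl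
  proof -
    have "length rl = tapes M" using that by auto
    from wf_tm_delta[OF _ _ this that(2), of q] Run(3) have
      l: "length (snd (delta M q rl)) = tapes M" and
      s: "fst ` set (snd (delta M q rl)) \<subseteq> {..<symbols M}" by auto
    have "snd (delta M q rl) ! (i - n) \<in> set (snd (delta M q rl))"
      using l that by (intro nth_mem) auto
    then show ?thesis using s that Run(4) by auto
  qed
  then show ?case using Run by (auto simp: idle_def Let_def)
qed (auto simp: idle_def)

section \<open>Step semantics and compilation\<close>

definition prog_step :: "prog \<times> (nat \<Rightarrow> tape) \<Rightarrow> prog \<times> (nat \<Rightarrow> tape)" where
  "prog_step c =
     (let (d, acts) = transition (fst c) (\<lambda>i. snd c i 0) in (d, \<lambda>i. act (acts i) (snd c i)))"

lemma act_Stay [simp]: "act (t 0, Stay) t = t"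
  by (simp add: act_def)

lemma act_idle [simp]: "act (idle (\<lambda>i. ts i 0) j) (ts j) = ts j"
  by (simp add: idle_def)

lemma prog_step_Halt [simp]: "prog_step (Halt b, ts) = (Halt b, ts)"
  by (simp add: prog_step_def)

lemma prog_steps_Halt [simp]: "(prog_step ^^ n) (Halt b, ts) = (Halt b, ts)"
  by (induction n) auto

definition input_tapes :: "bool list \<Rightarrow> nat \<Rightarrow> tape" where
  "input_tapes x i = string_tape (if i = 0 then x else [])"

lemma string_tape_Nil: "string_tape [] = (\<lambda>_. blank)"
  by (rule ext) (simp add: string_tape_def)

text \<open>
  The states of the machine are the residual programs of \<open>c\<close>, in an arbitrary numbering.
\<close>

lemma prog_compile:
  assumes c: "ok c"
  obtains M where "wf_tm M"
    "\<And>x n b ts. (prog_step ^^ n) (c, input_tapes x) = (Halt b, ts) \<Longrightarrow>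
       fst ((step M ^^ n) (initial M x)) = (if b then accept M else reject M) \<and>
       hd (snd ((step M ^^ n) (initial M x))) = ts 0"
proof -
  define Q where "Q = residuals c \<union> {Halt True, Halt False}"
  define K where "K = tapes_bound c"
  define S where "S = symbols_bound c"
  have "finite Q" by (simp add: Q_def finite_residuals)
  then obtain enc where enc: "bij_betw enc Q {..<card Q}"
    by (metis ex_bij_betw_finite_nat atLeast0LessThan)
  define dec where "dec = inv_into Q enc"
  have dec: "dec (enc d) = d" if "d \<in> Q" for d
    using enc that by (auto simp: dec_def bij_betw_def)
  have dec_Q: "dec q \<in> Q" if "q < card Q" for q
    using enc that by (auto simp: dec_def bij_betw_def inv_into_into)
  have enc_less: "enc d < card Q" if "d \<in> Q" for d
    using enc that by (auto simp: bij_betw_def)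
  have inQ: "c \<in> Q" "Halt True \<in> Q" "Halt False \<in> Q"
    by (auto simp: Q_def self_in_residuals c)
  have next_Q: "fst (transition d rs) \<in> Q" if "d \<in> Q" for d rs
    using that transition_in_residuals[OF c] by (auto simp: Q_def)
  have okQ: "ok d \<and> tapes_bound d \<le> K \<and> symbols_bound d \<le> S" if "d \<in> Q" for d
    using that residuals_ok[OF c] one_le_tapes_bound[of c] three_le_symbols_bound[of c]
    by (auto simp: Q_def K_def S_def)
  define rd where "rd rs = (\<lambda>i. if i < K then rs ! i else blank)" for rs :: "symbol list"
  define M where "M = \<lparr>tapes = K, symbols = S, states = card Q, start = enc c,
    accept = enc (Halt True), reject = enc (Halt False),
    delta = \<lambda>q rs. (enc (fst (transition (dec q) (rd rs))), map (snd (transition (dec q) (rd rs))) [0..<K])\<rparr>"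
  have M: "tapes M = K" "symbols M = S" "states M = card Q" "start M = enc c"
    "accept M = enc (Halt True)" "reject M = enc (Halt False)"
    "delta M q rs = (enc (fst (transition (dec q) (rd rs))), map (snd (transition (dec q) (rd rs))) [0..<K])"
    for q rs by (simp_all add: M_def)
  have inj: "enc d = enc d' \<longleftrightarrow> d = d'" if "d \<in> Q" "d' \<in> Q" for d d'
    using dec that by metis
  have K: "1 \<le> K" and S: "3 \<le> S"
    using one_le_tapes_bound three_le_symbols_bound by (auto simp: K_def S_def)
  have "wf_tm M"
    unfolding wf_tm_def M
  proof (intro conjI allI impI)
    fix q rs assume a: "q < card Q \<and> length rs = K \<and> set rs \<subseteq> {..<S}"
    have rd: "rd rs i < S" for i
      using a S by (auto simp: rd_def blank_def subset_iff)
    then have "fst (snd (transition (dec q) (rd rs)) i) < S" for i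
      using a dec_Q okQ transition_symbol_less by metis
    then show "case (enc (fst (transition (dec q) (rd rs))), map (snd (transition (dec q) (rd rs))) [0..<K]) of
      (q', acts) \<Rightarrow> q' < card Q \<and> length acts = K \<and> fst ` set acts \<subseteq> {..<S}"
      using a dec_Q next_Q enc_less by auto
  qed (use K S inQ enc_less inj in auto)
  moreover have sim: "fst ((step M ^^ n) (initial M x)) = (if b then accept M else reject M) \<and>
       hd (snd ((step M ^^ n) (initial M x))) = ts 0"
    if *: "(prog_step ^^ n) (c, input_tapes x) = (Halt b, ts)" for x n b ts
  proof -
    \<comment> \<open>Beyond \<open>K\<close> tapes \<open>rd\<close> supplies blanks. The last
      conjunct of the invariant says that these are what the program really scans there.\<close>
    have inv: "\<exists>d ts. (prog_step ^^ n) (c, input_tapes x) = (d, ts) \<and>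
      (step M ^^ n) (initial M x) = (enc d, map ts [0..<K]) \<and> d \<in> Q \<and> (\<forall>i\<ge>K. ts i = (\<lambda>_. blank))"
      for n
    proof (induction n)
      case 0
      have "string_tape x # replicate (K - 1) (\<lambda>_. blank) = map (input_tapes x) [0..<K]"
        using K by (auto intro!: nth_equalityI simp: input_tapes_def nth_Cons string_tape_Nil
          split: nat.splits)
      then show ?case using inQ K by (auto simp: initial_def M input_tapes_def string_tape_Nil)
    next
      case (Suc n)
      then obtain d ts where IH: "(prog_step ^^ n) (c, input_tapes x) = (d, ts)"
        "(step M ^^ n) (initial M x) = (enc d, map ts [0..<K])" "d \<in> Q" "\<forall>i\<ge>K. ts i = (\<lambda>_. blank)"
        by blast
      have rd: "rd (map (\<lambda>t. t 0) (map ts [0..<K])) = (\<lambda>i. ts i 0)"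
        using IH(4) by (auto simp: rd_def)
      define d' where "d' = fst (transition d (\<lambda>i. ts i 0))"
      define acts where "acts = snd (transition d (\<lambda>i. ts i 0))"
      have p: "prog_step (d, ts) = (d', \<lambda>i. act (acts i) (ts i))"
        by (simp add: prog_step_def d'_def acts_def case_prod_beta Let_def)
      have "step M (enc d, map ts [0..<K]) = (enc d', map (\<lambda>i. act (acts i) (ts i)) [0..<K])"
      proof (cases "\<exists>b. d = Halt b")
        case True
        then have "enc d = accept M \<or> enc d = reject M"
          by (auto simp: M) (metis (full_types))
        with True show ?thesis
          by (auto simp: step_def halted_def d'_def acts_def)
      next
        case False
        then have "enc d \<noteq> accept M" "enc d \<noteq> reject M" using inj inQ IH(3) by (auto simp: M)
        moreover have "delta M (enc d) (map (\<lambda>t. t 0) (map ts [0..<K])) = (enc d', map acts [0..<K])"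
          unfolding M rd using dec[OF IH(3)] by (simp add: d'_def acts_def)
        ultimately show ?thesis
          by (simp add: step_def halted_def)
            (auto intro!: nth_equalityI)
      qed
      moreover have "d' \<in> Q" using next_Q[OF IH(3)] by (simp add: d'_def)
      moreover have "\<forall>i\<ge>K. act (acts i) (ts i) = (\<lambda>_. blank)"
        using IH(4) okQ[OF IH(3)] transition_idle_outside[of d] unfolding acts_def
        by (metis act_Stay le_trans)
      ultimately show ?case using IH p by auto
    qed
    from inv[of n] have "(step M ^^ n) (initial M x) = (enc (Halt b), map ts [0..<K])"
      using * by auto
    then show ?thesis using K by (auto simp: M hd_map)
  qed
  ultimately show ?thesis using that by blast
qed

section \<open>Registers\<close>

definition halts ::
  "bool \<Rightarrow> prog \<Rightarrow> (nat \<Rightarrow> tape) \<Rightarrow> nat \<Rightarrow> (nat \<Rightarrow> tape) \<Rightarrow> bool" where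
  "halts b c ts T ts' \<longleftrightarrow> (prog_step ^^ T) (c, ts) = (Halt b, ts')"

abbreviation runs :: "prog \<Rightarrow> (nat \<Rightarrow> tape) \<Rightarrow> nat \<Rightarrow> (nat \<Rightarrow> tape) \<Rightarrow> bool" where
  "runs \<equiv> halts True"

text \<open>\<open>Halt b\<close> steps to itself, so the time in \<open>halts\<close> is only an
  upper bound and different branches can be given a common one.\<close>

lemma runs_mono:
  assumes "halts b c ts T ts'" "T \<le> T'"
  shows "halts b c ts T' ts'"
proof -
  have "(prog_step ^^ T') (c, ts) = (prog_step ^^ (T' - T)) ((prog_step ^^ T) (c, ts))"
    using assms(2) by (simp flip: funpow_add comp_apply[of "_ ^^ _" "_ ^^ _"])
  then show ?thesis using assms(1) by (simp add: halts_def)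
qed

lemma runs_conv:
  "runs c ts T ts1 \<Longrightarrow> T \<le> T' \<Longrightarrow> ts1 = ts' \<Longrightarrow> runs c ts T' ts'"
  using runs_mono by blast

lemma runs_stepI:
  assumes "prog_step (c, ts) = (d, ts1)" "halts b d ts1 T ts'"
  shows "halts b c ts (Suc T) ts'"
  using assms by (simp add: halts_def funpow_Suc_right del: funpow.simps)

lemma runs_Halt: "halts b (Halt b) ts T ts"
  by (simp add: halts_def)

lemma runs_Act: "runs (Act i f) ts 1 (ts(i := act (f (ts i 0)) (ts i)))"
  by (auto simp: halts_def prog_step_def idle_def fun_eq_iff)

lemma prog_step_Seq:
  "prog_step (Seq c d, ts) =
     (if is_Halt c then (d, ts)
      else (Seq (fst (prog_step (c, ts))) d, snd (prog_step (c, ts))))"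
  by (auto simp: prog_step_def Let_def case_prod_beta)

lemma runs_Seq:
  assumes "runs c ts T ts1" "halts b d ts1 T' ts'"
  shows "halts b (Seq c d) ts (T + T' + 1) ts'"
  using assms(1)
proof (induction T arbitrary: c ts)
  case 0
  then have "prog_step (Seq c d, ts) = (d, ts1)" by (simp add: halts_def prog_step_Seq)
  from runs_stepI[OF this assms(2)] show ?case by simp
next
  case (Suc T)
  show ?case
  proof (cases "is_Halt c")
    case True
    then have "ts = ts1" using Suc.prems by (cases c) (auto simp: halts_def funpow_swap1)
    with True have "prog_step (Seq c d, ts) = (d, ts1)" by (simp add: prog_step_Seq)
    from runs_stepI[OF this assms(2)] show ?thesis by (rule runs_mono) simp
  next
    case False
    obtain c1 ts2 where s: "prog_step (c, ts) = (c1, ts2)" by fastforce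
    then have "runs c1 ts2 T ts1"
      using Suc.prems by (simp add: halts_def funpow_Suc_right del: funpow.simps)
    from Suc.IH[OF this] have "halts b (Seq c1 d) ts2 (T + T' + 1) ts'" .
    moreover have "prog_step (Seq c d, ts) = (Seq c1 d, ts2)"
      using False s by (simp add: prog_step_Seq)
    ultimately show ?thesis using runs_stepI by fastforce
  qed
qed

lemma runs_Branch:
  assumes "halts b (if P (ts i 0) then c else d) ts T ts'"
  shows "halts b (Branch i P c d) ts (Suc T) ts'"
  by (rule runs_stepI[OF _ assms]) (simp add: prog_step_def)

lemma runs_Loop_end: "\<not> P (ts i 0) \<Longrightarrow> runs (Loop i P c) ts 1 ts"
  by (simp add: halts_def prog_step_def)

lemma runs_Loop_step:
  assumes "P (ts i 0)" "runs c ts T ts1" "runs (Loop i P c) ts1 T' ts'"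
  shows "runs (Loop i P c) ts (T + T' + 2) ts'"
proof -
  have "prog_step (Loop i P c, ts) = (Seq c (Loop i P c), ts)"
    using assms(1) by (simp add: prog_step_def)
  from runs_stepI[OF this runs_Seq[OF assms(2,3)]] show ?thesis by simp
qed

text \<open>A register holds a bit string, kept on its tape as a stack whose top is under the head.\<close>

definition regs :: "(nat \<Rightarrow> bool list) \<Rightarrow> nat \<Rightarrow> tape" where
  "regs \<sigma> i = string_tape (\<sigma> i)"

definition reg_runs ::
  "prog \<Rightarrow> (nat \<Rightarrow> bool list) \<Rightarrow> nat \<Rightarrow> (nat \<Rightarrow> bool list) \<Rightarrow> bool" where
  "reg_runs c \<sigma> T \<sigma>' \<longleftrightarrow> runs c (regs \<sigma>) T (regs \<sigma>')"

lemma regs_upd: "regs (\<sigma>(i := x)) = (regs \<sigma>)(i := string_tape x)"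
  by (auto simp: regs_def)

lemma string_tape_top: "string_tape x 0 = (case x of [] \<Rightarrow> blank | b # _ \<Rightarrow> bit_symbol b)"
  by (cases x) (auto simp: string_tape_def)

lemma bit_symbol_neq_blank [simp]: "bit_symbol b \<noteq> blank"
  by (simp add: bit_symbol_def blank_def)

lemma bit_symbol_eq_2 [simp]: "bit_symbol b = 2 \<longleftrightarrow> b"
  by (simp add: bit_symbol_def)

definition push :: "nat \<Rightarrow> bool \<Rightarrow> prog" where
  "push i b = Seq (Act i (\<lambda>s. (s, Move_Left))) (Act i (\<lambda>_. (bit_symbol b, Stay)))"

definition pop :: "nat \<Rightarrow> prog" where
  "pop i = Act i (\<lambda>_. (blank, Move_Right))"

lemma ok_push [simp]: "ok (push i b)"
  by (simp add: push_def small_writes_def bit_symbol_def)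

lemma ok_pop [simp]: "ok (pop i)"
  by (simp add: pop_def small_writes_def blank_def)

lemma string_tape_Cons:
  "(\<lambda>i. string_tape x (i - 1))(0 := bit_symbol b) = string_tape (b # x)"
proof (rule ext)
  fix i :: int
  show "((\<lambda>i. string_tape x (i - 1))(0 := bit_symbol b)) i = string_tape (b # x) i"
  proof (cases "i > 0")
    case True
    then have "nat i = Suc (nat (i - 1))" by simp
    with True show ?thesis by (auto simp: string_tape_def)
  qed (auto simp: string_tape_def)
qed

lemma string_tape_tl: "(\<lambda>i. ((string_tape x)(0 := blank)) (i + 1)) = string_tape (tl x)"
proof (rule ext)
  fix i :: int
  show "((string_tape x)(0 := blank)) (i + 1) = string_tape (tl x) i"
  proof (cases "i \<ge> 0")
    case True
    then have "nat (i + 1) = Suc (nat i)" by simp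
    with True show ?thesis by (cases x) (auto simp: string_tape_def)
  qed (auto simp: string_tape_def)
qed

lemma act_move: "act (t 0, d) t = move_head d t"
  by (simp add: act_def)

lemma runs_push:
  assumes "ts i = string_tape x"
  shows "runs (push i b) ts 3 (ts(i := string_tape (b # x)))"
proof -
  let ?ts = "ts(i := (\<lambda>j. string_tape x (j - 1)))"
  have "runs (Act i (\<lambda>s. (s, Move_Left))) ts 1 ?ts"
    using runs_Act[of i "\<lambda>s. (s, Move_Left)" ts] assms by (simp add: act_move)
  moreover have "runs (Act i (\<lambda>_. (bit_symbol b, Stay))) ?ts 1 (ts(i := string_tape (b # x)))"
    using runs_Act[of i "\<lambda>_. (bit_symbol b, Stay)" ?ts] string_tape_Cons[of x b]
    by (simp add: act_def)
  ultimately have "runs (push i b) ts (1 + 1 + 1) (ts(i := string_tape (b # x)))"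
    unfolding push_def by (rule runs_Seq)
  then show ?thesis by (rule runs_mono) simp
qed

lemma runs_pop:
  assumes "ts i = string_tape x"
  shows "runs (pop i) ts 1 (ts(i := string_tape (tl x)))"
  using runs_Act[of i "\<lambda>_. (blank, Move_Right)" ts] assms string_tape_tl[of x]
  by (simp add: pop_def act_def)

text \<open>The iteration consumes the register, top bit first; the body no longer sees the bit on
  the register and knows it by being \<open>c\<close> or \<open>d\<close>. The literal 2 is
  \<open>bit_symbol True\<close>.\<close>

definition each_bit :: "nat \<Rightarrow> prog \<Rightarrow> prog \<Rightarrow> prog" where
  "each_bit i c d = Loop i (\<lambda>s. s \<noteq> blank)
     (Branch i (\<lambda>s. s = 2) (Seq (pop i) c) (Seq (pop i) d))"

lemma ok_each_bit [simp]: "ok (each_bit i c d) \<longleftrightarrow> ok c \<and> ok d"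
  by (simp add: each_bit_def)

lemma runs_each_bit_Nil: "ts i = string_tape [] \<Longrightarrow> runs (each_bit i c d) ts 1 ts"
  unfolding each_bit_def by (rule runs_Loop_end) (simp add: string_tape_top)

lemma runs_each_bit_Cons:
  assumes "ts i = string_tape (b # x)"
    and "runs (if b then c else d) (ts(i := string_tape x)) T ts1"
    and "runs (each_bit i c d) ts1 T' ts'"
  shows "runs (each_bit i c d) ts (T + T' + 5) ts'"
proof -
  have "runs (pop i) ts 1 (ts(i := string_tape x))"
    using runs_pop[of ts i "b # x"] assms(1) by simp
  from runs_Seq[OF this assms(2)]
  have "runs (if b then Seq (pop i) c else Seq (pop i) d) ts (1 + T + 1) ts1"
    by auto
  then have "runs (Branch i (\<lambda>s. s = 2) (Seq (pop i) c) (Seq (pop i) d)) ts (Suc (1 + T + 1)) ts1"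
    by (intro runs_Branch) (simp add: assms(1) string_tape_top)
  from runs_Loop_step[OF _ this assms(3)[unfolded each_bit_def]]
  have "runs (each_bit i c d) ts (Suc (1 + T + 1) + T' + 2) ts'"
    by (simp add: assms(1) string_tape_top each_bit_def)
  then show ?thesis by (rule runs_mono) simp
qed

lemma reg_runs_mono: "reg_runs c \<sigma> T \<sigma>' \<Longrightarrow> T \<le> T' \<Longrightarrow> reg_runs c \<sigma> T' \<sigma>'"
  unfolding reg_runs_def by (rule runs_mono)

lemma reg_runs_conv:
  "reg_runs c \<sigma> T \<sigma>' \<Longrightarrow> T \<le> T' \<Longrightarrow> \<sigma>' = \<sigma>'' \<Longrightarrow> reg_runs c \<sigma> T' \<sigma>''"
  using reg_runs_mono by blast

lemma reg_runs_Halt: "reg_runs (Halt True) \<sigma> 0 \<sigma>"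
  by (simp add: reg_runs_def runs_Halt)

lemma reg_runs_Seq:
  "reg_runs c \<sigma> T \<sigma>1 \<Longrightarrow> reg_runs d \<sigma>1 T' \<sigma>' \<Longrightarrow> reg_runs (Seq c d) \<sigma> (T + T' + 1) \<sigma>'"
  unfolding reg_runs_def by (rule runs_Seq)

lemma reg_runs_push: "reg_runs (push i b) \<sigma> 3 (\<sigma>(i := b # \<sigma> i))"
  unfolding reg_runs_def regs_upd by (rule runs_push) (simp add: regs_def)

lemma reg_runs_pop: "reg_runs (pop i) \<sigma> 1 (\<sigma>(i := tl (\<sigma> i)))"
  unfolding reg_runs_def regs_upd by (rule runs_pop) (simp add: regs_def)

lemma reg_runs_each_bit_Nil: "\<sigma> i = [] \<Longrightarrow> reg_runs (each_bit i c d) \<sigma> 1 \<sigma>"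
  unfolding reg_runs_def by (rule runs_each_bit_Nil) (simp add: regs_def)

lemma reg_runs_each_bit_Cons:
  assumes "\<sigma> i = b # x"
    and "reg_runs (if b then c else d) (\<sigma>(i := x)) T \<sigma>1"
    and "reg_runs (each_bit i c d) \<sigma>1 T' \<sigma>'"
  shows "reg_runs (each_bit i c d) \<sigma> (T + T' + 5) \<sigma>'"
  using assms unfolding reg_runs_def regs_upd
  by (intro runs_each_bit_Cons) (auto simp: regs_def)

definition branch_top :: "nat \<Rightarrow> prog \<Rightarrow> prog \<Rightarrow> prog \<Rightarrow> prog" where
  "branch_top i c0 c1 c2 = Branch i (\<lambda>s. s = blank) c0 (Branch i (\<lambda>s. s = 2) c1 c2)"

lemma ok_branch_top [simp]: "ok (branch_top i c0 c1 c2) \<longleftrightarrow> ok c0 \<and> ok c1 \<and> ok c2"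
  by (simp add: branch_top_def)

lemma reg_runs_branch_top:
  assumes "reg_runs (case \<sigma> i of [] \<Rightarrow> c0 | b # _ \<Rightarrow> if b then c1 else c2) \<sigma> T \<sigma>'"
  shows "reg_runs (branch_top i c0 c1 c2) \<sigma> (T + 2) \<sigma>'"
proof (cases "\<sigma> i")
  case Nil
  then have "runs (branch_top i c0 c1 c2) (regs \<sigma>) (Suc T) (regs \<sigma>')"
    using assms unfolding branch_top_def reg_runs_def
    by (intro runs_Branch) (simp add: regs_def string_tape_top)
  then show ?thesis unfolding reg_runs_def by (rule runs_mono) simp
next
  case (Cons b x)
  then have "runs (Branch i (\<lambda>s. s = 2) c1 c2) (regs \<sigma>) (Suc T) (regs \<sigma>')"
    using assms unfolding reg_runs_def
    by (intro runs_Branch) (simp add: regs_def string_tape_top)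
  then have "runs (branch_top i c0 c1 c2) (regs \<sigma>) (Suc (Suc T)) (regs \<sigma>')"
    unfolding branch_top_def using Cons
    by (intro runs_Branch) (simp add: regs_def string_tape_top)
  then show ?thesis unfolding reg_runs_def by simp
qed

section \<open>Clearing, moving and copying registers\<close>

definition clear :: "nat \<Rightarrow> prog" where
  "clear i = each_bit i (Halt True) (Halt True)"

definition drain :: "nat \<Rightarrow> nat \<Rightarrow> prog" where
  "drain i j = each_bit i (push j True) (push j False)"

definition drain2 :: "nat \<Rightarrow> nat \<Rightarrow> nat \<Rightarrow> prog" where
  "drain2 i j k =
     each_bit i (Seq (push j True) (push k True)) (Seq (push j False) (push k False))"

lemma ok_clear [simp]: "ok (clear i)"
  by (simp add: clear_def)

lemma ok_drain [simp]: "ok (drain i j)"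
  by (simp add: drain_def)

lemma ok_drain2 [simp]: "ok (drain2 i j k)"
  by (simp add: drain2_def)

lemma reg_runs_clear: "reg_runs (clear i) \<sigma> (5 * length (\<sigma> i) + 1) (\<sigma>(i := []))"
proof (induction "\<sigma> i" arbitrary: \<sigma>)
  case Nil
  then have "\<sigma>(i := []) = \<sigma>" by (metis fun_upd_triv)
  then show ?case using reg_runs_each_bit_Nil[of \<sigma> i] Nil by (simp add: clear_def)
next
  case (Cons b x)
  have "reg_runs (clear i) (\<sigma>(i := x)) (5 * length x + 1) (\<sigma>(i := []))"
    using Cons.hyps(1)[of "\<sigma>(i := x)"] by simp
  from reg_runs_each_bit_Cons[of \<sigma> i b x, OF Cons.hyps(2)[symmetric] _ this[unfolded clear_def], of 0]
  show ?case using Cons.hyps(2)[symmetric] reg_runs_Halt by (simp add: clear_def)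
qed

lemma reg_runs_drain:
  assumes "i \<noteq> j"
  shows "reg_runs (drain i j) \<sigma> (8 * length (\<sigma> i) + 1) (\<sigma>(i := [], j := rev (\<sigma> i) @ \<sigma> j))"
proof (induction "\<sigma> i" arbitrary: \<sigma>)
  case Nil
  show ?case
    unfolding drain_def
    by (rule reg_runs_conv[OF reg_runs_each_bit_Nil]) (use Nil[symmetric] in auto)
next
  case (Cons b x)
  have "reg_runs (drain i j) (\<sigma>(i := x, j := b # \<sigma> j)) (8 * length x + 1)
     (\<sigma>(i := x, j := b # \<sigma> j, i := [], j := rev x @ b # \<sigma> j))"
    using Cons.hyps(1)[of "\<sigma>(i := x, j := b # \<sigma> j)"] assms by simp
  also have "\<sigma>(i := x, j := b # \<sigma> j, i := [], j := rev x @ b # \<sigma> j) =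
    \<sigma>(i := [], j := rev (\<sigma> i) @ \<sigma> j)"
    using Cons.hyps(2)[symmetric] assms by auto
  finally have *: "reg_runs (drain i j) (\<sigma>(i := x, j := b # \<sigma> j)) (8 * length x + 1)
     (\<sigma>(i := [], j := rev (\<sigma> i) @ \<sigma> j))" .
  have "reg_runs (if b then push j True else push j False) (\<sigma>(i := x)) 3 (\<sigma>(i := x, j := b # \<sigma> j))"
    using reg_runs_push[of j b "\<sigma>(i := x)"] assms by (cases b) simp_all
  from reg_runs_each_bit_Cons[of \<sigma> i b x, OF Cons.hyps(2)[symmetric] this *[unfolded drain_def]]
  show ?case using Cons.hyps(2)[symmetric] by (simp add: drain_def)
qed

lemma reg_runs_drain2:
  assumes "i \<noteq> j" "i \<noteq> k" "j \<noteq> k"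
  shows "reg_runs (drain2 i j k) \<sigma> (12 * length (\<sigma> i) + 1)
     (\<sigma>(i := [], j := rev (\<sigma> i) @ \<sigma> j, k := rev (\<sigma> i) @ \<sigma> k))"
proof (induction "\<sigma> i" arbitrary: \<sigma>)
  case Nil
  show ?case
    unfolding drain2_def
    by (rule reg_runs_conv[OF reg_runs_each_bit_Nil]) (use Nil[symmetric] in auto)
next
  case (Cons b x)
  let ?\<sigma> = "\<sigma>(i := x, j := b # \<sigma> j, k := b # \<sigma> k)"
  let ?\<sigma>' = "\<sigma>(i := [], j := rev (\<sigma> i) @ \<sigma> j, k := rev (\<sigma> i) @ \<sigma> k)"
  have "reg_runs (drain2 i j k) ?\<sigma> (12 * length x + 1)
     (?\<sigma>(i := [], j := rev x @ b # \<sigma> j, k := rev x @ b # \<sigma> k))"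
    using Cons.hyps(1)[of ?\<sigma>] assms by simp
  also have "?\<sigma>(i := [], j := rev x @ b # \<sigma> j, k := rev x @ b # \<sigma> k) = ?\<sigma>'"
    using Cons.hyps(2)[symmetric] assms by auto
  finally have *: "reg_runs (drain2 i j k) ?\<sigma> (12 * length x + 1) ?\<sigma>'" .
  have "reg_runs (Seq (push j b) (push k b)) (\<sigma>(i := x)) (3 + 3 + 1) ?\<sigma>"
    using reg_runs_Seq[OF reg_runs_push[of j b "\<sigma>(i := x)"] reg_runs_push[of k b]] assms by simp
  then have "reg_runs (if b then Seq (push j True) (push k True) else Seq (push j False) (push k False))
    (\<sigma>(i := x)) 7 ?\<sigma>" by (cases b) simp_all
  from reg_runs_each_bit_Cons[of \<sigma> i b x, OF Cons.hyps(2)[symmetric] this *[unfolded drain2_def]]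
  show ?case using Cons.hyps(2)[symmetric] by (simp add: drain2_def)
qed

text \<open>Draining reverses a stack, so a second drain by way of the scratch register
  \<open>w\<close> restores the order.\<close>

definition move_reg :: "nat \<Rightarrow> nat \<Rightarrow> nat \<Rightarrow> prog" where
  "move_reg w i j = Seq (drain i w) (drain w j)"

definition copy_reg :: "nat \<Rightarrow> nat \<Rightarrow> nat \<Rightarrow> prog" where
  "copy_reg w i j = Seq (drain i w) (drain2 w i j)"

lemma ok_move_reg [simp]: "ok (move_reg w i j)"
  by (simp add: move_reg_def)

lemma ok_copy_reg [simp]: "ok (copy_reg w i j)"
  by (simp add: copy_reg_def)

lemma reg_runs_move_reg:
  assumes "i \<noteq> w" "j \<noteq> w" "\<sigma> w = []" "i \<noteq> j \<Longrightarrow> \<sigma> j = []"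
  shows "reg_runs (move_reg w i j) \<sigma> (16 * length (\<sigma> i) + 3) (\<sigma>(i := [], j := \<sigma> i))"
  unfolding move_reg_def
  by (rule reg_runs_conv[OF reg_runs_Seq[OF reg_runs_drain reg_runs_drain]]) (use assms in auto)

lemma reg_runs_copy_reg:
  assumes "i \<noteq> w" "j \<noteq> w" "i \<noteq> j" "\<sigma> w = []" "\<sigma> j = []"
  shows "reg_runs (copy_reg w i j) \<sigma> (20 * length (\<sigma> i) + 3) (\<sigma>(j := \<sigma> i))"
  unfolding copy_reg_def
  by (rule reg_runs_conv[OF reg_runs_Seq[OF reg_runs_drain reg_runs_drain2]]) (use assms in auto)

section \<open>Machines as subroutines\<close>

definition overlay :: "nat \<Rightarrow> tape list \<Rightarrow> (nat \<Rightarrow> tape) \<Rightarrow> nat \<Rightarrow> tape" where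
  "overlay n tapes' ts i = (if n \<le> i \<and> i < n + length tapes' then tapes' ! (i - n) else ts i)"

definition wf_config :: "tm \<Rightarrow> config \<Rightarrow> bool" where
  "wf_config M c \<longleftrightarrow> fst c < states M \<and> length (snd c) = tapes M \<and>
     (\<forall>t \<in> set (snd c). \<forall>i. t i < symbols M)"

lemma act_cases:
  "act (s, d) t i = (t(0 := s)) (case d of Move_Left \<Rightarrow> i - 1 | Stay \<Rightarrow> i | Move_Right \<Rightarrow> i + 1)"
  by (cases d) (simp_all add: act_def)

lemma wf_config_step:
  assumes M: "wf_tm M" and c: "wf_config M c"
  shows "wf_config M (step M c)"
proof (cases "halted M c")
  case True
  then show ?thesis using c by (simp add: step_def)
next
  case False
  let ?rl = "map (\<lambda>t. t 0) (snd c)"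
  have "fst c < states M" "length ?rl = tapes M" "set ?rl \<subseteq> {..<symbols M}"
    using c by (auto simp: wf_config_def)
  note d = wf_tm_delta[OF M this]
  have "act a t i < symbols M" if at: "(a, t) \<in> set (zip (snd (delta M (fst c) ?rl)) (snd c))" for a t i
  proof -
    have "t \<in> set (snd c)" using at by (rule set_zip_rightD)
    moreover have "fst a < symbols M" using set_zip_leftD[OF at] d(3) by auto
    ultimately show ?thesis
      using c act_cases[of "fst a" "snd a" t i] by (auto simp: wf_config_def)
  qed
  then show ?thesis
    using False d c by (auto simp: wf_config_def step_def case_prod_beta)
qed

lemma wf_config_initial: "wf_tm M \<Longrightarrow> wf_config M (initial M x)"
  by (auto simp: wf_config_def initial_def wf_tm_def string_tape_def bit_symbol_def blank_def)

lemma prog_step_Run: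
  assumes M: "wf_tm M" and c: "wf_config M cfg" and "\<not> halted M cfg"
  shows "prog_step (Run M (fst cfg) n c d, overlay n (snd cfg) ts) =
    (Run M (fst (step M cfg)) n c d, overlay n (snd (step M cfg)) ts)"
proof -
  let ?rl = "map (\<lambda>t. t 0) (snd cfg)"
  have wf: "fst cfg < states M" "length ?rl = tapes M" "set ?rl \<subseteq> {..<symbols M}"
    using c by (auto simp: wf_config_def)
  note d = wf_tm_delta[OF M this]
  have rl: "map (\<lambda>i. overlay n (snd cfg) ts i 0) [n..<n + tapes M] = ?rl"
    using wf(2) by (auto intro!: nth_equalityI simp: overlay_def)
  have q: "fst cfg \<noteq> accept M" "fst cfg \<noteq> reject M"
    using assms(3) by (auto simp: halted_def)
  have s: "step M cfg = (fst (delta M (fst cfg) ?rl), map2 act (snd (delta M (fst cfg) ?rl)) (snd cfg))"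
    using assms(3) by (simp add: step_def case_prod_beta)
  have "act (if n \<le> i \<and> i < n + tapes M then snd (delta M (fst cfg) ?rl) ! (i - n)
        else idle (\<lambda>i. overlay n (snd cfg) ts i 0) i) (overlay n (snd cfg) ts i)
      = overlay n (snd (step M cfg)) ts i" for i
    using wf(2) d(2) by (auto simp: overlay_def s idle_def)
  then show ?thesis
    using q wf(3) by (simp add: prog_step_def rl s Let_def)
qed

text \<open>One step beyond \<open>t\<close> passes control to \<open>c\<close> or \<open>d\<close>.
  The time \<open>t\<close> may exceed the moment of halting, as halted configurations are fixed
  points of \<open>step\<close>.\<close>

lemma runs_Run:
  assumes M: "wf_tm M" and "wf_config M cfg" and "halted M ((step M ^^ t) cfg)"
    and "runs (if fst ((step M ^^ t) cfg) = accept M then c else d)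
      (overlay n (snd ((step M ^^ t) cfg)) ts) T ts'"
  shows "runs (Run M (fst cfg) n c d) (overlay n (snd cfg) ts) (t + 1 + T) ts'"
  using assms(2-)
proof (induction t arbitrary: cfg)
  case 0
  then have "prog_step (Run M (fst cfg) n c d, overlay n (snd cfg) ts) =
    ((if fst cfg = accept M then c else d), overlay n (snd cfg) ts)"
    by (auto simp: prog_step_def halted_def)
  from runs_stepI[OF this] 0 show ?case by simp
next
  case (Suc t)
  show ?case
  proof (cases "halted M cfg")
    case True
    then have "step M cfg = cfg" by (simp add: step_def)
    then have "(step M ^^ Suc t) cfg = (step M ^^ t) cfg"
      by (simp add: funpow_Suc_right del: funpow.simps)
    with Suc have "runs (Run M (fst cfg) n c d) (overlay n (snd cfg) ts) (t + 1 + T) ts'" by metis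
    then show ?thesis by (rule runs_mono) simp
  next
    case False
    note s = prog_step_Run[OF M Suc.prems(1) False]
    have "runs (Run M (fst (step M cfg)) n c d) (overlay n (snd (step M cfg)) ts) (t + 1 + T) ts'"
      using Suc.prems(2,3) wf_config_step[OF M Suc.prems(1)]
      by (intro Suc.IH) (simp_all add: funpow_Suc_right del: funpow.simps)
    from runs_stepI[OF s this] show ?thesis by simp
  qed
qed

section \<open>Bounding and erasing what a machine leaves behind\<close>

definition supported :: "nat \<Rightarrow> tape \<Rightarrow> bool" where
  "supported K t \<longleftrightarrow> (\<forall>i. \<bar>i\<bar> > int K \<longrightarrow> t i = blank)"

text \<open>The head remains at cell 0 by renumbering, so a move shifts the entire contents by one
  cell, including the symbol just written.\<close>

lemma supported_act: "supported K t \<Longrightarrow> supported (Suc K) (act a t)"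
  by (cases a, cases "snd a") (auto simp: supported_def act_cases)

lemma supported_step:
  assumes "\<forall>t \<in> set (snd c). supported K t"
  shows "\<forall>t \<in> set (snd (step M c)). supported (Suc K) t"
proof -
  have "supported (Suc K) t" if "supported K t" for t
    using that by (simp add: supported_def)
  then show ?thesis
    using assms supported_act
    by (auto simp: step_def case_prod_beta dest!: set_zip_rightD)
qed

lemma supported_string_tape: "supported (length x) (string_tape x)"
  by (auto simp: supported_def string_tape_def)

text \<open>Together with \<open>supported_run\<close> this bounds the length of an output by the
  input length plus the running time.\<close>

lemma length_le_of_supported:
  assumes "supported K (string_tape x)" shows "length x \<le> Suc K"
proof (rule ccontr)
  assume "\<not> length x \<le> Suc K"
  then have "string_tape x (int (Suc K)) = bit_symbol (x ! Suc K)"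
    unfolding string_tape_def by (simp del: of_nat_Suc)
  moreover have "string_tape x (int (Suc K)) = blank" using assms by (simp add: supported_def)
  ultimately show False using bit_symbol_neq_blank by metis
qed

lemma supported_run:
  "\<forall>u \<in> set (snd ((step M ^^ t) (initial M x))). supported (length x + t) u"
proof (induction t)
  case 0
  show ?case using supported_string_tape[of x] by (auto simp: initial_def supported_def)
next
  case (Suc t)
  then show ?case using supported_step by auto
qed

lemma wf_config_run: "wf_tm M \<Longrightarrow> wf_config M ((step M ^^ t) (initial M x))"
  by (induction t) (auto intro: wf_config_initial wf_config_step)

text \<open>Each tick taken from the unary clock \<open>a\<close> is put onto \<open>b\<close>. The
  next sweep, with the two exchanged, therefore finds the clock intact.\<close>

definition sweep :: "nat \<Rightarrow> nat \<Rightarrow> nat \<Rightarrow> move \<Rightarrow> prog" where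
  "sweep a b j d = each_bit a (Seq (Act j (\<lambda>_. (blank, d))) (push b True))
     (Seq (Act j (\<lambda>_. (blank, d))) (push b True))"

lemma ok_sweep [simp]: "ok (sweep a b j d)"
  by (simp add: sweep_def small_writes_def blank_def)

lemma runs_sweep:
  assumes "a \<noteq> b" "j \<noteq> a" "j \<noteq> b"
    and "ts a = string_tape (replicate n True)" "ts b = string_tape (replicate m True)"
  shows "runs (sweep a b j d) ts (10 * n + 1)
    (ts(a := string_tape [], b := string_tape (replicate (n + m) True),
        j := (act (blank, d) ^^ n) (ts j)))"
  using assms(4,5)
proof (induction n arbitrary: ts m)
  case 0
  show ?case
    unfolding sweep_def
    by (rule runs_conv[OF runs_each_bit_Nil]) (use 0 in auto)
next
  case (Suc n)
  let ?ts0 = "ts(a := string_tape (replicate n True))"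
  let ?ts1 = "?ts0(j := act (blank, d) (ts j))"
  let ?ts2 = "?ts1(b := string_tape (replicate (Suc m) True))"
  have "runs (Act j (\<lambda>_. (blank, d))) ?ts0 1 ?ts1"
    using runs_Act[of j "\<lambda>_. (blank, d)" ?ts0] assms by simp
  moreover have "runs (push b True) ?ts1 3 ?ts2"
    using runs_push[of ?ts1 b "replicate m True" True] Suc.prems assms by simp
  ultimately have 1: "runs (Seq (Act j (\<lambda>_. (blank, d))) (push b True)) ?ts0 (1 + 3 + 1) ?ts2"
    by (rule runs_Seq)
  have 2: "runs (sweep a b j d) ?ts2 (10 * n + 1)
    (?ts2(a := string_tape [], b := string_tape (replicate (n + Suc m) True),
        j := (act (blank, d) ^^ n) (?ts2 j)))"
    by (rule Suc.IH) (use Suc.prems assms in auto)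
  have "?ts2(a := string_tape [], b := string_tape (replicate (n + Suc m) True),
        j := (act (blank, d) ^^ n) (?ts2 j)) =
    ts(a := string_tape [], b := string_tape (replicate (Suc n + m) True),
        j := (act (blank, d) ^^ Suc n) (ts j))"
    using assms by (auto simp: funpow_swap1)
  with 2 have 3: "runs (sweep a b j d) ?ts2 (10 * n + 1)
    (ts(a := string_tape [], b := string_tape (replicate (Suc n + m) True),
        j := (act (blank, d) ^^ Suc n) (ts j)))" by simp
  have "ts a = string_tape (True # replicate n True)" using Suc.prems by simp
  from runs_each_bit_Cons[of ts a True "replicate n True", OF this _ 3[unfolded sweep_def], of "1 + 3 + 1"] 1
  have "runs (sweep a b j d) ts (1 + 3 + 1 + (10 * n + 1) + 5)
    (ts(a := string_tape [], b := string_tape (replicate (Suc n + m) True),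
        j := (act (blank, d) ^^ Suc n) (ts j)))"
    unfolding sweep_def by simp
  then show ?case by (rule runs_mono) simp
qed

lemma sweep_right:
  "(act (blank, Move_Right) ^^ n) t i = (if - int n \<le> i \<and> i < 0 then blank else t (i + int n))"
  by (induction n arbitrary: i) (auto simp: act_cases algebra_simps)

lemma sweep_left:
  "(act (blank, Move_Left) ^^ n) t i = (if 0 < i \<and> i \<le> int n then blank else t (i - int n))"
  by (induction n arbitrary: i) (auto simp: act_cases algebra_simps)

lemma sweep_blank: "(act (blank, Stay) ^^ n) (\<lambda>_. blank) = (\<lambda>_. blank)"
proof (induction n)
  case (Suc n)
  have "act (blank, Stay) (\<lambda>_. blank) = (\<lambda>_. blank)" by (auto simp: act_def)
  with Suc show ?case by simp
qed simp

text \<open>With \<open>n\<close> ticks, and cells counted from the initial head position, the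
  sweeps blank 0 up to n - 1, then n down to 1, then 0 down to -(n - 1). This covers a support of
  radius less than \<open>n\<close>. The last sweep does nothing but carry the clock from
  \<open>b\<close> back to \<open>a\<close>.\<close>

definition erase :: "nat \<Rightarrow> nat \<Rightarrow> nat \<Rightarrow> prog" where
  "erase a b j = Seq (sweep a b j Move_Right) (Seq (sweep b a j Move_Left)
     (Seq (sweep a b j Move_Left) (sweep b a j Stay)))"

lemma ok_erase [simp]: "ok (erase a b j)"
  by (simp add: erase_def)

lemma runs_erase:
  assumes "a \<noteq> b" "j \<noteq> a" "j \<noteq> b"
    and a: "ts a = string_tape (replicate n True)" and b: "ts b = string_tape []"
    and K: "supported K (ts j)" "K < n"
  shows "runs (erase a b j) ts (40 * n + 7) (ts(j := string_tape []))"
proof -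
  let ?r = "act (blank, Move_Right) ^^ n" and ?l = "act (blank, Move_Left) ^^ n"
    and ?s = "act (blank, Stay) ^^ n" and ?one = "string_tape (replicate n True)"
  let ?u = "ts j"
  have "?l (?l (?r ?u)) = (\<lambda>_. blank)"
  proof (rule ext)
    fix i
    show "?l (?l (?r ?u)) i = blank"
      using K by (auto simp: sweep_left sweep_right supported_def)
  qed
  then have e: "?s (?l (?l (?r ?u))) = string_tape []"
    by (simp add: sweep_blank string_tape_Nil)
  have 1: "runs (sweep a b j Move_Right) ts (10 * n + 1)
    (ts(a := string_tape [], b := ?one, j := ?r ?u))"
    using runs_sweep[of a b j ts n 0] assms by simp
  have 2: "runs (sweep b a j Move_Left) (ts(a := string_tape [], b := ?one, j := ?r ?u))
    (10 * n + 1) (ts(j := ?l (?r ?u)))" (is "runs _ ?ts1 _ ?ts2")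
  proof -
    have "?ts1(b := string_tape [], a := ?one, j := ?l (?ts1 j)) = ?ts2"
      using assms by (auto simp: fun_eq_iff)
    then show ?thesis using runs_sweep[of b a j ?ts1 n 0 Move_Left] assms by simp
  qed
  have 3: "runs (sweep a b j Move_Left) ?ts2 (10 * n + 1)
    (?ts2(a := string_tape [], b := ?one, j := ?l (?ts2 j)))" (is "runs _ _ _ ?ts3")
    using runs_sweep[of a b j ?ts2 n 0] assms by simp
  have 4: "runs (sweep b a j Stay) ?ts3 (10 * n + 1) (ts(j := string_tape []))"
  proof -
    have "?ts3(b := string_tape [], a := ?one, j := ?s (?ts3 j)) = ts(j := string_tape [])"
      using assms e by (auto simp: fun_eq_iff)
    then show ?thesis using runs_sweep[of b a j ?ts3 n 0 Stay] assms by simp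
  qed
  show ?thesis
    unfolding erase_def
    by (rule runs_mono[OF runs_Seq[OF 1 runs_Seq[OF 2 runs_Seq[OF 3 4]]]]) simp
qed

fun erase_tapes :: "nat \<Rightarrow> nat \<Rightarrow> nat \<Rightarrow> nat \<Rightarrow> prog" where
  "erase_tapes a b j 0 = Halt True"
| "erase_tapes a b j (Suc k) = Seq (erase a b j) (erase_tapes a b (Suc j) k)"

lemma ok_erase_tapes [simp]: "ok (erase_tapes a b j k)"
  by (induction k arbitrary: j) simp_all

lemma runs_erase_tapes:
  assumes "a \<noteq> b" "a < j" "b < j"
    and "ts a = string_tape (replicate n True)" and "ts b = string_tape []"
    and "\<And>i. j \<le> i \<Longrightarrow> i < j + k \<Longrightarrow> supported K (ts i)" and "K < n"
  shows "runs (erase_tapes a b j k) ts (k * (40 * n + 8))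
    (\<lambda>i. if j \<le> i \<and> i < j + k then string_tape [] else ts i)"
  using assms
proof (induction k arbitrary: j ts)
  case 0
  show ?case
    unfolding erase_tapes.simps by (rule runs_conv[OF runs_Halt]) (auto simp: fun_eq_iff)
next
  case (Suc k)
  have 1: "runs (erase a b j) ts (40 * n + 7) (ts(j := string_tape []))"
    using Suc.prems by (intro runs_erase) auto
  have 2: "runs (erase_tapes a b (Suc j) k) (ts(j := string_tape [])) (k * (40 * n + 8))
    (\<lambda>i. if Suc j \<le> i \<and> i < Suc j + k then string_tape [] else (ts(j := string_tape [])) i)"
    using Suc.prems by (intro Suc.IH) auto
  have "(\<lambda>i. if Suc j \<le> i \<and> i < Suc j + k then string_tape [] else (ts(j := string_tape [])) i) =
    (\<lambda>i. if j \<le> i \<and> i < j + Suc k then string_tape [] else ts i)"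
    by (auto simp: fun_eq_iff)
  with runs_Seq[OF 1 2]
  have "runs (erase_tapes a b j (Suc k)) ts (40 * n + 7 + k * (40 * n + 8) + 1)
    (\<lambda>i. if j \<le> i \<and> i < j + Suc k then string_tape [] else ts i)" by simp
  then show ?case by (rule runs_mono) simp
qed

lemma overlay_initial:
  assumes "tapes M \<ge> 1" "\<sigma> n = x" "\<And>i. n < i \<Longrightarrow> i < n + tapes M \<Longrightarrow> \<sigma> i = []"
  shows "overlay n (snd (initial M x)) (regs \<sigma>) = regs \<sigma>"
  using assms by (auto simp: fun_eq_iff overlay_def initial_def regs_def nth_Cons string_tape_Nil
    split: nat.splits)

text \<open>
  The unary clock in register \<open>a\<close> bounds how far the heads can have travelled, so that the work
  tapes can be blanked afterwards.
\<close>

lemma reg_runs_function: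
  assumes M: "wf_tm M" and n: "a \<noteq> b" "a < n" "b < n"
    and "\<sigma> a = replicate m True" "\<sigma> b = []" "\<And>i. n < i \<Longrightarrow> i < n + tapes M \<Longrightarrow> \<sigma> i = []"
    and h: "halted M ((step M ^^ t) (initial M (\<sigma> n)))"
      "hd (snd ((step M ^^ t) (initial M (\<sigma> n)))) = string_tape y"
    and m: "length (\<sigma> n) + t < m"
  shows "reg_runs (Seq (Run M (start M) n (Halt True) (Halt True))
      (erase_tapes a b (Suc n) (tapes M - 1))) \<sigma> (t + 2 + tapes M * (40 * m + 8)) (\<sigma>(n := y))"
proof -
  let ?c = "(step M ^^ t) (initial M (\<sigma> n))"
  let ?ts = "overlay n (snd ?c) (regs \<sigma>)"
  have k: "tapes M \<ge> 1" using M by (simp add: wf_tm_def)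
  have i: "fst (initial M (\<sigma> n)) = start M" by (simp add: initial_def)
  have len: "length (snd ?c) = tapes M" using wf_config_run[OF M] by (simp add: wf_config_def)
  have sup: "supported (length (\<sigma> n) + t) (snd ?c ! i)" if "i < tapes M" for i
    using supported_run[of t M "\<sigma> n"] len that by (metis nth_mem)
  have "runs (Run M (fst (initial M (\<sigma> n))) n (Halt True) (Halt True))
    (overlay n (snd (initial M (\<sigma> n))) (regs \<sigma>)) (t + 1 + 0) ?ts"
    using h(1) by (intro runs_Run M wf_config_initial) (auto simp: runs_Halt)
  then have 1: "runs (Run M (start M) n (Halt True) (Halt True)) (regs \<sigma>) (t + 1) ?ts"
    using overlay_initial[of M \<sigma> n, OF k refl assms(7)] i by simp
  have 2: "runs (erase_tapes a b (Suc n) (tapes M - 1)) ?ts ((tapes M - 1) * (40 * m + 8))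
    (\<lambda>i. if Suc n \<le> i \<and> i < Suc n + (tapes M - 1) then string_tape [] else ?ts i)"
    by (rule runs_erase_tapes[where K = "length (\<sigma> n) + t"])
      (use n k len sup m assms in \<open>auto simp: overlay_def regs_def\<close>)
  have "snd ?c ! 0 = string_tape y" using h(2) len k by (cases "snd ?c") auto
  then have "(\<lambda>i. if Suc n \<le> i \<and> i < Suc n + (tapes M - 1) then string_tape [] else ?ts i)
    = regs (\<sigma>(n := y))"
    using k len assms(7) by (auto simp: fun_eq_iff overlay_def regs_def)
  with runs_Seq[OF 1 2] show ?thesis
    unfolding reg_runs_def by (auto elim!: runs_mono simp: diff_mult_distrib)
qed

text \<open>A decision leaves unspecified contents on the machine's first tape as well, so the
  clean-up starts at \<open>n\<close> itself. The verdict has been saved in \<open>r\<close>, below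
  the tapes to be erased.\<close>

lemma reg_runs_decider:
  assumes M: "wf_tm M" and n: "a \<noteq> b" "a < n" "b < n" "r < n" "r \<noteq> a" "r \<noteq> b"
    and "\<sigma> a = replicate m True" "\<sigma> b = []" "\<sigma> r = []"
    and "\<And>i. n < i \<Longrightarrow> i < n + tapes M \<Longrightarrow> \<sigma> i = []"
    and h: "halted M ((step M ^^ t) (initial M (\<sigma> n)))"
    and m: "length (\<sigma> n) + t < m"
  shows "reg_runs (Seq (Run M (start M) n (push r True) (push r False))
      (erase_tapes a b n (tapes M))) \<sigma> (t + 5 + tapes M * (40 * m + 8))
    (\<sigma>(n := [], r := [fst ((step M ^^ t) (initial M (\<sigma> n))) = accept M]))"
proof -
  let ?c = "(step M ^^ t) (initial M (\<sigma> n))"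
  let ?res = "string_tape [fst ?c = accept M]"
  let ?ts = "(overlay n (snd ?c) (regs \<sigma>))(r := ?res)"
  have k: "tapes M \<ge> 1" using M by (simp add: wf_tm_def)
  have i: "fst (initial M (\<sigma> n)) = start M" by (simp add: initial_def)
  have len: "length (snd ?c) = tapes M" using wf_config_run[OF M] by (simp add: wf_config_def)
  have sup: "supported (length (\<sigma> n) + t) (snd ?c ! i)" if "i < tapes M" for i
    using supported_run[of t M "\<sigma> n"] len that by (metis nth_mem)
  have p: "runs (push r b) (overlay n (snd ?c) (regs \<sigma>)) 3
      ((overlay n (snd ?c) (regs \<sigma>))(r := string_tape [b]))" for b
    using n assms by (intro runs_push) (simp add: overlay_def regs_def)
  have "runs (Run M (fst (initial M (\<sigma> n))) n (push r True) (push r False))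
    (overlay n (snd (initial M (\<sigma> n))) (regs \<sigma>)) (t + 1 + 3) ?ts"
    using h(1) p by (intro runs_Run M wf_config_initial) auto
  then have 1: "runs (Run M (start M) n (push r True) (push r False)) (regs \<sigma>) (t + 4) ?ts"
    using overlay_initial[of M \<sigma> n, OF k refl assms(11)] i by (simp add: add.commute)
  have 2: "runs (erase_tapes a b n (tapes M)) ?ts (tapes M * (40 * m + 8))
    (\<lambda>i. if n \<le> i \<and> i < n + tapes M then string_tape [] else ?ts i)"
    by (rule runs_erase_tapes[where K = "length (\<sigma> n) + t"])
      (use n k len sup m assms in \<open>auto simp: overlay_def regs_def\<close>)
  have "(\<lambda>i. if n \<le> i \<and> i < n + tapes M then string_tape [] else ?ts i)
    = regs (\<sigma>(n := [], r := [fst ?c = accept M]))"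
    using k len assms(11) n by (auto simp: fun_eq_iff overlay_def regs_def)
  with runs_Seq[OF 1 2] show ?thesis
    unfolding reg_runs_def by (auto elim!: runs_mono)
qed

section \<open>Polynomial-time functions of several strings\<close>

type_synonym env = "nat \<Rightarrow> bool list"

section \<open>Polynomial bounds in several strings\<close>

definition env_size :: "nat \<Rightarrow> env \<Rightarrow> nat" where
  "env_size n e = (\<Sum>i<n. length (e i))"

text \<open>An environment has infinitely many variables and no total length; hence the number
  \<open>n\<close> of variables that count is chosen along with the polynomial.\<close>

definition poly_bounded :: "(env \<Rightarrow> nat) \<Rightarrow> bool" where
  "poly_bounded T \<longleftrightarrow> (\<exists>n p. \<forall>e. T e \<le> poly p (env_size n e))"

lemma poly_mono_nat: "a \<le> b \<Longrightarrow> poly p a \<le> poly p b" for a b :: nat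
  by (induction p) (auto intro: add_mono mult_mono)

lemma env_size_mono: "n \<le> m \<Longrightarrow> env_size n e \<le> env_size m e"
  unfolding env_size_def by (rule sum_mono2) auto

lemma poly_boundedI: "(\<And>e. T e \<le> poly p (env_size n e)) \<Longrightarrow> poly_bounded T"
  unfolding poly_bounded_def by blast

lemma poly_boundedE:
  assumes "poly_bounded T"
  obtains n0 p where "\<And>n e. n0 \<le> n \<Longrightarrow> T e \<le> poly p (env_size n e)"
proof -
  obtain n0 p where *: "\<And>e. T e \<le> poly p (env_size n0 e)"
    using assms unfolding poly_bounded_def by blast
  show thesis
    by (rule that[of n0 p]) (meson * env_size_mono poly_mono_nat le_trans)
qed

lemma poly_bounded_mono: "poly_bounded T \<Longrightarrow> (\<And>e. S e \<le> T e) \<Longrightarrow> poly_bounded S"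
  unfolding poly_bounded_def by (meson le_trans)

lemma poly_bounded_const: "poly_bounded (\<lambda>_. c)"
  by (rule poly_boundedI[of _ "[:c:]" 0]) simp

lemma poly_bounded_length: "poly_bounded (\<lambda>e. length (e i))"
  by (rule poly_boundedI[of _ "[:0, 1:]" "Suc i"]) (simp add: env_size_def)

lemma poly_bounded_add:
  assumes "poly_bounded S" "poly_bounded T"
  shows "poly_bounded (\<lambda>e. S e + T e)"
proof -
  obtain n p where 1: "\<And>m e. n \<le> m \<Longrightarrow> S e \<le> poly p (env_size m e)"
    using poly_boundedE[OF assms(1)] by blast
  obtain m q where 2: "\<And>n e. m \<le> n \<Longrightarrow> T e \<le> poly q (env_size n e)"
    using poly_boundedE[OF assms(2)] by blast
  show ?thesis
    by (rule poly_boundedI[of _ "p + q" "max n m"]) (simp add: 1 2 add_mono)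
qed

lemma poly_bounded_mult:
  assumes "poly_bounded S" "poly_bounded T"
  shows "poly_bounded (\<lambda>e. S e * T e)"
proof -
  obtain n p where 1: "\<And>m e. n \<le> m \<Longrightarrow> S e \<le> poly p (env_size m e)"
    using poly_boundedE[OF assms(1)] by blast
  obtain m q where 2: "\<And>n e. m \<le> n \<Longrightarrow> T e \<le> poly q (env_size n e)"
    using poly_boundedE[OF assms(2)] by blast
  show ?thesis
    by (rule poly_boundedI[of _ "p * q" "max n m"]) (simp add: 1 2 mult_mono)
qed

lemma poly_bounded_poly:
  assumes "poly_bounded T"
  shows "poly_bounded (\<lambda>e. poly p (T e))"
proof -
  obtain n q where 1: "\<And>m e. n \<le> m \<Longrightarrow> T e \<le> poly q (env_size m e)"
    using poly_boundedE[OF assms] by blast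
  show ?thesis
    by (rule poly_boundedI[of _ "pcompose p q" n]) (simp add: poly_pcompose 1 poly_mono_nat)
qed

lemma poly_bounded_env_size: "poly_bounded (env_size n)"
  by (rule poly_boundedI[of _ "[:0, 1:]" n]) simp

lemma poly_bounded_shift:
  assumes "poly_bounded T"
  shows "poly_bounded (\<lambda>e. T (\<lambda>i. e (Suc i)))"
proof -
  obtain n p where 1: "\<And>m e. n \<le> m \<Longrightarrow> T e \<le> poly p (env_size m e)"
    using poly_boundedE[OF assms] by blast
  have "env_size n (\<lambda>i. e (Suc i)) \<le> env_size (Suc n) e" for e
    by (simp add: env_size_def sum.lessThan_Suc_shift del: sum.lessThan_Suc)
  then show ?thesis
    by (intro poly_boundedI[of _ p "Suc n"]) (meson 1 le_trans poly_mono_nat order_refl)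
qed

lemma env_size_case_nat: "env_size n (case_nat x e) \<le> length x + env_size n e"
proof (cases n)
  case (Suc m)
  have "env_size m e \<le> env_size n e" using Suc by (simp add: env_size_mono)
  then show ?thesis
    by (simp add: Suc env_size_def sum.lessThan_Suc_shift del: sum.lessThan_Suc)
qed (simp add: env_size_def)

text \<open>Variable 0 will be the accumulator of a fold. A bound on its length turns a time bound
  that involves the accumulator into one in the remaining variables, valid for all rounds.\<close>

lemma poly_bounded_case_nat:
  assumes "poly_bounded T" "poly_bounded B"
  obtains U where "poly_bounded U" "\<And>e x. length x \<le> B e \<Longrightarrow> T (case_nat x e) \<le> U e"
proof -
  obtain n p where 1: "\<And>m e. n \<le> m \<Longrightarrow> T e \<le> poly p (env_size m e)"
    using poly_boundedE[OF assms(1)] by blast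
  have "T (case_nat x e) \<le> poly p (B e + env_size n e)" if "length x \<le> B e" for x e
    using env_size_case_nat[of n x e] that
    by (intro order.trans[OF 1 poly_mono_nat]) auto
  moreover have "poly_bounded (\<lambda>e. poly p (B e + env_size n e))"
    by (rule poly_bounded_poly[OF poly_bounded_add[OF assms(2) poly_bounded_env_size]])
  ultimately show thesis using that by blast
qed

lemma poly_bounded_unary:
  assumes "poly_bounded T"
  obtains p where "\<And>x. T (case_nat x (\<lambda>_. [])) \<le> poly p (length x)"
proof -
  obtain n p where 1: "\<And>m e. n \<le> m \<Longrightarrow> T e \<le> poly p (env_size m e)"
    using poly_boundedE[OF assms(1)] by blast
  have "env_size n (case_nat x (\<lambda>_. [])) \<le> length x" for x
    using env_size_case_nat[of n x "\<lambda>_. []"] by (simp add: env_size_def)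
  then show thesis
    by (intro that[of p]) (meson 1 le_trans poly_mono_nat order_refl)
qed

lemmas poly_bounded_intros =
  poly_bounded_const poly_bounded_length poly_bounded_add poly_bounded_mult poly_bounded_poly

text \<open>
  A function of finitely many strings, given as a function of environments. The program finds the
  variable \<open>i\<close> in register \<open>\<rho> i\<close> and leaves the result in register \<open>r\<close>; the registers from \<open>w\<close> on
  are empty before and after. As \<open>\<rho>\<close> need not be injective but has a finite range, programs
  compose without copying their inputs.
\<close>

definition layout :: "(nat \<Rightarrow> nat) \<Rightarrow> nat \<Rightarrow> nat \<Rightarrow> bool" where
  "layout \<rho> r w \<longleftrightarrow> r < w \<and> (\<forall>i. \<rho> i < w \<and> \<rho> i \<noteq> r)"

definition computes ::
  "prog \<Rightarrow> (env \<Rightarrow> nat) \<Rightarrow> (nat \<Rightarrow> nat) \<Rightarrow> nat \<Rightarrow> nat \<Rightarrow> (env \<Rightarrow> bool list) \<Rightarrow> bool" where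
  "computes c T \<rho> r w f \<longleftrightarrow> ok c \<and>
     (\<forall>\<sigma>. \<sigma> r = [] \<and> (\<forall>i\<ge>w. \<sigma> i = []) \<longrightarrow>
       reg_runs c \<sigma> (T (\<lambda>i. \<sigma> (\<rho> i))) (\<sigma>(r := f (\<lambda>i. \<sigma> (\<rho> i)))))"

text \<open>The time bound is chosen before the layout: wherever the program is placed, and whatever
  registers it shares, the same bound applies. The bound on the result pays for clearing and moving
  it.\<close>

definition feasible :: "(env \<Rightarrow> bool list) \<Rightarrow> bool" where
  "feasible f \<longleftrightarrow> poly_bounded (\<lambda>e. length (f e)) \<and>
     (\<exists>T. poly_bounded T \<and> (\<forall>\<rho> r w. layout \<rho> r w \<longrightarrow> (\<exists>c. computes c T \<rho> r w f)))"

lemma feasibleI: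
  assumes "poly_bounded (\<lambda>e. length (f e))" "poly_bounded T"
    and "\<And>\<rho> r w. layout \<rho> r w \<Longrightarrow> \<exists>c. computes c T \<rho> r w f"
  shows "feasible f"
  using assms unfolding feasible_def by blast

lemma feasible_length: "feasible f \<Longrightarrow> poly_bounded (\<lambda>e. length (f e))"
  by (simp add: feasible_def)

lemma feasibleE:
  assumes "feasible f"
  obtains T where "poly_bounded T" "\<And>\<rho> r w. layout \<rho> r w \<Longrightarrow> \<exists>c. computes c T \<rho> r w f"
  using assms unfolding feasible_def by blast

lemma computesI:
  assumes "ok c"
    and "\<And>\<sigma>. \<sigma> r = [] \<Longrightarrow> (\<And>i. w \<le> i \<Longrightarrow> \<sigma> i = []) \<Longrightarrow>
       reg_runs c \<sigma> (T (\<lambda>i. \<sigma> (\<rho> i))) (\<sigma>(r := f (\<lambda>i. \<sigma> (\<rho> i))))"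
  shows "computes c T \<rho> r w f"
  using assms unfolding computes_def by blast

lemma computes_ok: "computes c T \<rho> r w f \<Longrightarrow> ok c"
  by (simp add: computes_def)

lemma computesD:
  assumes "computes c T \<rho> r w f" "\<sigma> r = []" "\<And>i. w \<le> i \<Longrightarrow> \<sigma> i = []"
  shows "reg_runs c \<sigma> (T (\<lambda>i. \<sigma> (\<rho> i))) (\<sigma>(r := f (\<lambda>i. \<sigma> (\<rho> i))))"
  using assms unfolding computes_def by blast

lemma layoutD: "layout \<rho> r w \<Longrightarrow> r < w" "layout \<rho> r w \<Longrightarrow> \<rho> i < w" "layout \<rho> r w \<Longrightarrow> \<rho> i \<noteq> r"
  by (auto simp: layout_def)

lemma layout_fresh: "layout \<rho> r w \<Longrightarrow> w \<le> r' \<Longrightarrow> r' < w' \<Longrightarrow> layout \<rho> r' w'"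
  unfolding layout_def by (meson less_le_trans less_trans not_le)

section \<open>Closure properties of feasible functions\<close>

lemma feasible_var: "feasible (\<lambda>e. e i)"
proof (rule feasibleI)
  show "poly_bounded (\<lambda>e. 20 * length (e i) + 3)" by (intro poly_bounded_intros)
  show "\<exists>c. computes c (\<lambda>e. 20 * length (e i) + 3) \<rho> r w (\<lambda>e. e i)" if l: "layout \<rho> r w" for \<rho> r w
  proof (intro exI computesI)
    fix \<sigma> :: env assume "\<sigma> r = []" "\<And>i. w \<le> i \<Longrightarrow> \<sigma> i = []"
    then show "reg_runs (copy_reg w (\<rho> i) r) \<sigma> (20 * length (\<sigma> (\<rho> i)) + 3) (\<sigma>(r := \<sigma> (\<rho> i)))"
      using l by (intro reg_runs_copy_reg) (auto simp: layout_def)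
  qed simp
qed (rule poly_bounded_length)

lemma feasible_Nil: "feasible (\<lambda>_. [])"
proof (rule feasibleI)
  show "\<exists>c. computes c (\<lambda>_. 0) \<rho> r w (\<lambda>_. [])" for \<rho> r w
  proof (intro exI computesI)
    fix \<sigma> :: env assume "\<sigma> r = []"
    then show "reg_runs (Halt True) \<sigma> 0 (\<sigma>(r := []))"
      by (intro reg_runs_conv[OF reg_runs_Halt]) auto
  qed simp
qed (auto intro: poly_bounded_const)

lemma feasible_Cons:
  assumes "feasible f"
  shows "feasible (\<lambda>e. b # f e)"
proof -
  obtain T where T: "poly_bounded T" "\<And>\<rho> r w. layout \<rho> r w \<Longrightarrow> \<exists>c. computes c T \<rho> r w f"
    using feasibleE[OF assms] by blast
  show ?thesis
  proof (rule feasibleI)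
    show "poly_bounded (\<lambda>e. length (b # f e))"
      using poly_bounded_add[OF feasible_length[OF assms] poly_bounded_const[of 1]] by simp
    show "poly_bounded (\<lambda>e. T e + 4)" by (intro poly_bounded_intros T)
    show "\<exists>c. computes c (\<lambda>e. T e + 4) \<rho> r w (\<lambda>e. b # f e)" if l: "layout \<rho> r w" for \<rho> r w
    proof -
      obtain c where c: "computes c T \<rho> r w f" using T(2)[OF l] ..
      have "computes (Seq c (push r b)) (\<lambda>e. T e + 4) \<rho> r w (\<lambda>e. b # f e)"
      proof (rule computesI)
        fix \<sigma> :: env assume \<sigma>: "\<sigma> r = []" "\<And>i. w \<le> i \<Longrightarrow> \<sigma> i = []"
        show "reg_runs (Seq c (push r b)) \<sigma> (T (\<lambda>i. \<sigma> (\<rho> i)) + 4)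
          (\<sigma>(r := b # f (\<lambda>i. \<sigma> (\<rho> i))))"
          by (rule reg_runs_conv[OF reg_runs_Seq[OF computesD[OF c] reg_runs_push]]) (use \<sigma> in auto)
      qed (use computes_ok[OF c] in simp)
      then show ?thesis ..
    qed
  qed
qed

lemma feasible_tl:
  assumes "feasible f"
  shows "feasible (\<lambda>e. tl (f e))"
proof -
  obtain T where T: "poly_bounded T" "\<And>\<rho> r w. layout \<rho> r w \<Longrightarrow> \<exists>c. computes c T \<rho> r w f"
    using feasibleE[OF assms] by blast
  show ?thesis
  proof (rule feasibleI)
    show "poly_bounded (\<lambda>e. length (tl (f e)))"
      by (rule poly_bounded_mono[OF feasible_length[OF assms]]) simp
    show "poly_bounded (\<lambda>e. T e + 2)" by (intro poly_bounded_intros T)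
    show "\<exists>c. computes c (\<lambda>e. T e + 2) \<rho> r w (\<lambda>e. tl (f e))" if l: "layout \<rho> r w" for \<rho> r w
    proof -
      obtain c where c: "computes c T \<rho> r w f" using T(2)[OF l] ..
      have "computes (Seq c (pop r)) (\<lambda>e. T e + 2) \<rho> r w (\<lambda>e. tl (f e))"
      proof (rule computesI)
        fix \<sigma> :: env assume \<sigma>: "\<sigma> r = []" "\<And>i. w \<le> i \<Longrightarrow> \<sigma> i = []"
        show "reg_runs (Seq c (pop r)) \<sigma> (T (\<lambda>i. \<sigma> (\<rho> i)) + 2) (\<sigma>(r := tl (f (\<lambda>i. \<sigma> (\<rho> i)))))"
          by (rule reg_runs_conv[OF reg_runs_Seq[OF computesD[OF c] reg_runs_pop]]) (use \<sigma> in auto)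
      qed (use computes_ok[OF c] in simp)
      then show ?thesis ..
    qed
  qed
qed

text \<open>The one kind of case distinction in the calculus: the top of a register is missing, 1 or
  0. Truth values are passed around as one-bit strings.\<close>

definition cond :: "bool list \<Rightarrow> 'a \<Rightarrow> 'a \<Rightarrow> 'a \<Rightarrow> 'a" where
  "cond x a b c = (case x of [] \<Rightarrow> a | d # _ \<Rightarrow> if d then b else c)"

lemma cond_simps [simp]:
  "cond [] a b c = a" "cond (True # x) a b c = b" "cond (False # x) a b c = c"
  by (simp_all add: cond_def)

lemma feasible_cond:
  assumes "feasible g" "feasible f0" "feasible f1" "feasible f2"
  shows "feasible (\<lambda>e. cond (g e) (f0 e) (f1 e) (f2 e))"
proof -
  obtain T where T: "poly_bounded T" "\<And>\<rho> r w. layout \<rho> r w \<Longrightarrow> \<exists>c. computes c T \<rho> r w g"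
    using feasibleE[OF assms(1)] by blast
  obtain T0 where T0: "poly_bounded T0" "\<And>\<rho> r w. layout \<rho> r w \<Longrightarrow> \<exists>c. computes c T0 \<rho> r w f0"
    using feasibleE[OF assms(2)] by blast
  obtain T1 where T1: "poly_bounded T1" "\<And>\<rho> r w. layout \<rho> r w \<Longrightarrow> \<exists>c. computes c T1 \<rho> r w f1"
    using feasibleE[OF assms(3)] by blast
  obtain T2 where T2: "poly_bounded T2" "\<And>\<rho> r w. layout \<rho> r w \<Longrightarrow> \<exists>c. computes c T2 \<rho> r w f2"
    using feasibleE[OF assms(4)] by blast
  let ?T = "\<lambda>e. T e + (5 * length (g e) + (T0 e + (T1 e + T2 e)) + 5)"
  show ?thesis
  proof (rule feasibleI)
    have "length (cond x a b c) \<le> length a + (length b + length c)" for x and a b c :: "bool list"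
      by (auto simp: cond_def split: list.split)
    then show "poly_bounded (\<lambda>e. length (cond (g e) (f0 e) (f1 e) (f2 e)))"
      by (rule poly_bounded_mono[rotated])
        (intro poly_bounded_add feasible_length assms)
    show "poly_bounded ?T"
      by (intro poly_bounded_intros T T0 T1 T2 feasible_length assms)
    show "\<exists>c. computes c ?T \<rho> r w (\<lambda>e. cond (g e) (f0 e) (f1 e) (f2 e))"
      if l: "layout \<rho> r w" for \<rho> r w
    proof -
      obtain c where c: "computes c T \<rho> w (Suc w) g"
        using T(2)[OF layout_fresh[OF l]] by blast
      obtain c0 where c0: "computes c0 T0 \<rho> r w f0" using T0(2)[OF l] ..
      obtain c1 where c1: "computes c1 T1 \<rho> r w f1" using T1(2)[OF l] ..
      obtain c2 where c2: "computes c2 T2 \<rho> r w f2" using T2(2)[OF l] ..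
      \<comment> \<open>Each branch first clears the guard from \<open>w\<close>, because its own
        program expects all registers from \<open>w\<close> on to be empty.\<close>
      let ?p = "Seq c (branch_top w (Seq (clear w) c0) (Seq (clear w) c1) (Seq (clear w) c2))"
      have "computes ?p ?T \<rho> r w (\<lambda>e. cond (g e) (f0 e) (f1 e) (f2 e))"
      proof (rule computesI)
        fix \<sigma> :: env assume \<sigma>: "\<sigma> r = []" "\<And>i. w \<le> i \<Longrightarrow> \<sigma> i = []"
        define e where "e = (\<lambda>i. \<sigma> (\<rho> i))"
        have r: "r \<noteq> w" using layoutD(1)[OF l] by simp
        have 1: "reg_runs c \<sigma> (T e) (\<sigma>(w := g e))"
          unfolding e_def using \<sigma> by (intro computesD[OF c]) auto
        have \<sigma>': "\<sigma>(w := g e, w := []) = \<sigma>" using \<sigma>(2)[of w] by auto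
        have 2: "reg_runs (Seq (clear w) d) (\<sigma>(w := g e)) (5 * length (g e) + 1 + S e + 1)
            (\<sigma>(r := f e))"
          if "computes d S \<rho> r w f" for d S f
          using reg_runs_Seq[OF reg_runs_clear[of w "\<sigma>(w := g e)"], of d "S e" "\<sigma>(r := f e)"]
            computesD[of d S \<rho> r w f \<sigma>, OF that \<sigma>] \<sigma>' by (simp add: e_def)
        let ?m = "5 * length (g e) + (T0 e + (T1 e + T2 e)) + 2"
        have "reg_runs (Seq (clear w) c0) (\<sigma>(w := g e)) ?m (\<sigma>(r := f0 e))"
          "reg_runs (Seq (clear w) c1) (\<sigma>(w := g e)) ?m (\<sigma>(r := f1 e))"
          "reg_runs (Seq (clear w) c2) (\<sigma>(w := g e)) ?m (\<sigma>(r := f2 e))"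
          by (rule reg_runs_mono[OF 2[OF c0]] reg_runs_mono[OF 2[OF c1]] reg_runs_mono[OF 2[OF c2]],
              simp)+
        then have "reg_runs (branch_top w (Seq (clear w) c0) (Seq (clear w) c1) (Seq (clear w) c2))
            (\<sigma>(w := g e)) (?m + 2) (\<sigma>(r := cond (g e) (f0 e) (f1 e) (f2 e)))"
          by (intro reg_runs_branch_top) (auto split: list.split)
        from reg_runs_Seq[OF 1 this]
        show "reg_runs ?p \<sigma> (?T (\<lambda>i. \<sigma> (\<rho> i))) (\<sigma>(r := cond (g (\<lambda>i. \<sigma> (\<rho> i)))
            (f0 (\<lambda>i. \<sigma> (\<rho> i))) (f1 (\<lambda>i. \<sigma> (\<rho> i))) (f2 (\<lambda>i. \<sigma> (\<rho> i)))))"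
          unfolding e_def by (rule reg_runs_mono) simp
      qed (use c c0 c1 c2 in \<open>simp add: computes_ok\<close>)
      then show ?thesis ..
    qed
  qed
qed

text \<open>Renaming variables costs no time: the program for the renamed layout is already the
  right one.\<close>

lemma feasible_shift:
  assumes "feasible f"
  shows "feasible (\<lambda>e. f (\<lambda>i. e (Suc i)))"
proof -
  obtain T where T: "poly_bounded T" "\<And>\<rho> r w. layout \<rho> r w \<Longrightarrow> \<exists>c. computes c T \<rho> r w f"
    using feasibleE[OF assms] by blast
  show ?thesis
  proof (rule feasibleI)
    show "\<exists>c. computes c (\<lambda>e. T (\<lambda>i. e (Suc i))) \<rho> r w (\<lambda>e. f (\<lambda>i. e (Suc i)))"
      if l: "layout \<rho> r w" for \<rho> r w
    proof -
      have "layout (\<lambda>i. \<rho> (Suc i)) r w" using l by (simp add: layout_def)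
      from T(2)[OF this] show ?thesis by (auto simp: computes_def)
    qed
  qed (intro poly_bounded_shift[OF feasible_length[OF assms]] poly_bounded_shift[OF T(1)])+
qed

lemma layout_case_nat:
  assumes "layout \<rho> r w" "w \<le> i" "i < w'" "r' < w'" "r' = r \<or> w \<le> r'" "r' \<noteq> i"
  shows "layout (case_nat i \<rho>) r' w'"
proof -
  have "\<rho> j < w' \<and> \<rho> j \<noteq> r'" for j
    using layoutD(2,3)[OF assms(1), of j] assms(2-5) by auto
  then show ?thesis using assms by (simp add: layout_def split: nat.split)
qed

text \<open>A form of Cobham's limited recursion on notation. A round may lengthen the accumulator,
  which is variable 0 of the step function, by at most \<open>D e\<close>, where \<open>e\<close>
  does not include the accumulator. Without such a limit, doubling it in every round would produce
  results of exponential length.\<close>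

lemma feasible_foldr:
  fixes S :: "bool \<Rightarrow> env \<Rightarrow> bool list \<Rightarrow> bool list"
  assumes f: "feasible f" and g: "feasible g"
    and S: "\<And>b. feasible (\<lambda>e. S b (\<lambda>i. e (Suc i)) (e 0))"
    and D: "poly_bounded D" and S_D: "\<And>b e a. length (S b e a) \<le> length a + D e"
  shows "feasible (\<lambda>e. foldr (\<lambda>b. S b e) (f e) (g e))"
proof -
  define B where "B e = length (g e) + length (f e) * D e" for e
  have B: "poly_bounded B"
    unfolding B_def by (intro poly_bounded_intros feasible_length f g D)
  have fold_B: "length (foldr (\<lambda>b. S b e) l a) \<le> length a + length l * D e" for e l a
  proof (induction l)
    case (Cons b l)
    then show ?case using S_D[of b e "foldr (\<lambda>b. S b e) l a"] by simp
  qed simp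
  obtain Tf where Tf: "poly_bounded Tf" "\<And>\<rho> r w. layout \<rho> r w \<Longrightarrow> \<exists>c. computes c Tf \<rho> r w f"
    using feasibleE[OF f] by blast
  obtain Tg where Tg: "poly_bounded Tg" "\<And>\<rho> r w. layout \<rho> r w \<Longrightarrow> \<exists>c. computes c Tg \<rho> r w g"
    using feasibleE[OF g] by blast
  have "\<forall>b. \<exists>T. poly_bounded T \<and> (\<forall>\<rho> r w. layout \<rho> r w \<longrightarrow>
      (\<exists>c. computes c T \<rho> r w (\<lambda>e. S b (\<lambda>i. e (Suc i)) (e 0))))"
    using S unfolding feasible_def by blast
  from choice[OF this] obtain T where T: "\<And>b. poly_bounded (T b)"
    "\<And>b \<rho> r w. layout \<rho> r w \<Longrightarrow> \<exists>c. computes c (T b) \<rho> r w (\<lambda>e. S b (\<lambda>i. e (Suc i)) (e 0))"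
    by blast
  have "\<exists>U. poly_bounded U \<and> (\<forall>e x. length x \<le> B e \<longrightarrow> T b (case_nat x e) \<le> U e)" for b
    by (rule poly_bounded_case_nat[OF T(1)[of b] B]) blast
  then have "\<forall>b. \<exists>U. poly_bounded U \<and> (\<forall>e x. length x \<le> B e \<longrightarrow> T b (case_nat x e) \<le> U e)" ..
  from choice[OF this] obtain U where U: "\<And>b. poly_bounded (U b)"
    "\<And>b e x. length x \<le> B e \<Longrightarrow> T b (case_nat x e) \<le> U b e"
    by blast
  define K where "K e = U True e + U False e + 21 * B e + 12" for e
  have K: "poly_bounded K"
    unfolding K_def by (intro poly_bounded_intros U B)
  let ?T = "\<lambda>e. Tf e + 8 * length (f e) + Tg e + length (f e) * K e + 16 * B e + 20"
  show ?thesis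
  proof (rule feasibleI)
    show "poly_bounded (\<lambda>e. length (foldr (\<lambda>b. S b e) (f e) (g e)))"
      using fold_B by (intro poly_bounded_mono[OF B]) (simp add: B_def)
    show "poly_bounded ?T"
      by (intro poly_bounded_intros Tf Tg K B feasible_length f)
    show "\<exists>c. computes c ?T \<rho> r w (\<lambda>e. foldr (\<lambda>b. S b e) (f e) (g e))"
      if l: "layout \<rho> r w" for \<rho> r w
    proof -
      have r: "r < w" using layoutD(1)[OF l] .
      have \<rho>: "\<rho> i < w" for i using layoutD(2)[OF l] .
      \<comment> \<open>Register \<open>w\<close> holds the list and is scratch later,
        \<open>w + 1\<close> the reversed list, \<open>w + 2\<close> the accumulator,
        \<open>w + 3\<close> its next value, and \<open>w + 4\<close> is scratch for moving that
        back.\<close>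
      obtain cf where cf: "computes cf Tf \<rho> w (w + 1) f"
        using Tf(2)[OF layout_fresh[OF l]] by fastforce
      obtain cg where cg: "computes cg Tg \<rho> (w + 2) (w + 3) g"
        using Tg(2)[OF layout_fresh[OF l]] by fastforce
      have "layout (case_nat (w + 2) \<rho>) (w + 3) (w + 4)"
        using layout_case_nat[OF l] by simp
      then have "\<forall>b. \<exists>c. computes c (T b) (case_nat (w + 2) \<rho>) (w + 3) (w + 4)
          (\<lambda>e. S b (\<lambda>i. e (Suc i)) (e 0))"
        using T(2) by blast
      from choice[OF this] obtain cS where cS: "\<And>b. computes (cS b) (T b) (case_nat (w + 2) \<rho>)
          (w + 3) (w + 4) (\<lambda>e. S b (\<lambda>i. e (Suc i)) (e 0))"
        by blast
      define body where
        "body b = Seq (cS b) (Seq (clear (w + 2)) (move_reg (w + 4) (w + 3) (w + 2)))" for b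
      define loop where "loop = each_bit (w + 1) (body True) (body False)"
      have body: "reg_runs (body b) \<sigma> (U b e + 21 * B e + 6) (\<sigma>(w + 2 := S b e (\<sigma> (w + 2))))"
        if "\<And>i. w + 3 \<le> i \<Longrightarrow> \<sigma> i = []" "\<And>i. \<sigma> (\<rho> i) = e i" "length (\<sigma> (w + 2)) \<le> B e"
          "length (S b e (\<sigma> (w + 2))) \<le> B e" for b \<sigma> e
      proof -
        let ?a = "\<sigma> (w + 2)"
        let ?\<sigma> = "\<sigma>(w + 3 := S b e ?a)"
        have e: "(\<lambda>i. \<sigma> (case_nat (w + 2) \<rho> i)) = case_nat ?a e"
          using that(2) by (auto simp: fun_eq_iff split: nat.split)
        have 1: "reg_runs (cS b) \<sigma> (T b (case_nat ?a e)) ?\<sigma>"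
          using computesD[OF cS[of b], of \<sigma>] that(1) that(2)[abs_def] unfolding e by simp
        have 2: "reg_runs (clear (w + 2)) ?\<sigma> (5 * length ?a + 1) (?\<sigma>(w + 2 := []))"
          using reg_runs_clear[of "w + 2" ?\<sigma>] by simp
        have 3: "reg_runs (move_reg (w + 4) (w + 3) (w + 2)) (?\<sigma>(w + 2 := []))
            (16 * length (S b e ?a) + 3) (?\<sigma>(w + 2 := [], w + 3 := [], w + 2 := S b e ?a))"
          using reg_runs_move_reg[of "w + 3" "w + 4" "w + 2" "?\<sigma>(w + 2 := [])"] that(1) by simp
        have "?\<sigma>(w + 2 := [], w + 3 := [], w + 2 := S b e ?a) = \<sigma>(w + 2 := S b e ?a)"
          using that(1) by (auto simp: fun_eq_iff)
        then show ?thesis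
          unfolding body_def
          by (intro reg_runs_conv[OF reg_runs_Seq[OF 1 reg_runs_Seq[OF 2 3]]])
            (use U(2)[of ?a e b] that(3,4) in auto)
      qed
      have loop: "reg_runs loop \<sigma> (length (\<sigma> (w + 1)) * K e + 1)
          (\<sigma>(w + 1 := [], w + 2 := fold (\<lambda>b. S b e) (\<sigma> (w + 1)) (\<sigma> (w + 2))))"
        if "\<And>i. w + 3 \<le> i \<Longrightarrow> \<sigma> i = []" "\<And>i. \<sigma> (\<rho> i) = e i"
          "length (\<sigma> (w + 2)) + length (\<sigma> (w + 1)) * D e \<le> B e" for \<sigma> e
        using that
      proof (induction "\<sigma> (w + 1)" arbitrary: \<sigma>)
        case Nil
        show ?case
          unfolding loop_def
          by (rule reg_runs_conv[OF reg_runs_each_bit_Nil]) (use Nil(1) in auto)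
      next
        case (Cons b l)
        let ?a = "\<sigma> (w + 2)"
        let ?\<sigma> = "\<sigma>(w + 1 := l, w + 2 := S b e ?a)"
        have len: "length ?a + (D e + length l * D e) \<le> B e"
          using Cons.prems(3) Cons.hyps(2)[symmetric] by simp
        have S_len: "length (S b e ?a) \<le> length ?a + D e" by (rule S_D)
        have upd: "(\<sigma>(w + 1 := x, w + 2 := y)) (\<rho> i) = e i" for x y i
          using Cons.prems(2)[of i] \<rho>[of i] by simp
        have 1: "reg_runs (body b) (\<sigma>(w + 1 := l)) (U b e + 21 * B e + 6) ?\<sigma>"
          using body[of "\<sigma>(w + 1 := l)" e b] Cons.prems(1) upd[of l "\<sigma> (w + 2)"] len S_len
          by (simp add: fun_upd_idem)
        have 2: "reg_runs loop ?\<sigma> (length l * K e + 1)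
            (?\<sigma>(w + 1 := [], w + 2 := fold (\<lambda>b. S b e) l (S b e ?a)))"
          using Cons.hyps(1)[of ?\<sigma>] Cons.prems(1) upd len S_len by simp
        have 3: "?\<sigma>(w + 1 := [], w + 2 := fold (\<lambda>b. S b e) l (S b e ?a)) =
          \<sigma>(w + 1 := [], w + 2 := fold (\<lambda>b. S b e) (\<sigma> (w + 1)) ?a)"
          using Cons.hyps(2)[symmetric] by (auto simp: fun_eq_iff)
        have "reg_runs (if b then body True else body False) (\<sigma>(w + 1 := l))
            (U b e + 21 * B e + 6) ?\<sigma>"
          using 1 by (cases b) simp_all
        from reg_runs_each_bit_Cons[of \<sigma> "w + 1" b l, OF Cons.hyps(2)[symmetric] this
            2[unfolded loop_def]]
        show ?case
          unfolding loop_def 3[symmetric]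
          by (rule reg_runs_mono)
            (use Cons.hyps(2)[symmetric] in \<open>cases b; simp add: K_def\<close>)
      qed
      \<comment> \<open>\<open>foldr\<close> treats the last bit first. Draining the list into
        \<open>w + 1\<close> reverses it, so that the loop, popping from the top, meets the bits in
        this order.\<close>
      let ?p = "Seq cf (Seq (drain w (w + 1)) (Seq cg (Seq loop (move_reg w (w + 2) r))))"
      have "computes ?p ?T \<rho> r w (\<lambda>e. foldr (\<lambda>b. S b e) (f e) (g e))"
      proof (rule computesI)
        fix \<sigma> :: env assume \<sigma>: "\<sigma> r = []" "\<And>i. w \<le> i \<Longrightarrow> \<sigma> i = []"
        define e where "e = (\<lambda>i. \<sigma> (\<rho> i))"
        let ?res = "foldr (\<lambda>b. S b e) (f e) (g e)"
        let ?\<sigma>1 = "\<sigma>(w := f e)"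
        let ?\<sigma>2 = "\<sigma>(w + 1 := rev (f e))"
        let ?\<sigma>3 = "?\<sigma>2(w + 2 := g e)"
        let ?\<sigma>4 = "\<sigma>(w + 2 := ?res)"
        have 1: "reg_runs cf \<sigma> (Tf e) ?\<sigma>1"
          unfolding e_def using \<sigma> by (intro computesD[OF cf]) auto
        have 2: "reg_runs (drain w (w + 1)) ?\<sigma>1 (8 * length (f e) + 1) ?\<sigma>2"
          by (rule reg_runs_conv[OF reg_runs_drain]) (use \<sigma> in \<open>auto simp: fun_eq_iff\<close>)
        have neq: "\<rho> i \<noteq> Suc w" "\<rho> i \<noteq> Suc (Suc w)" for i
          using \<rho>[of i] by auto
        have e2: "(\<lambda>i. ?\<sigma>2 (\<rho> i)) = e" and e3: "?\<sigma>3 (\<rho> i) = e i" for i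
          using neq by (auto simp: e_def fun_eq_iff)
        have 3: "reg_runs cg ?\<sigma>2 (Tg e) ?\<sigma>3"
          using computesD[OF cg, of ?\<sigma>2] \<sigma> unfolding e2 by simp
        have 4: "reg_runs loop ?\<sigma>3 (length (f e) * K e + 1) ?\<sigma>4"
          by (rule reg_runs_conv[OF loop[of ?\<sigma>3 e]])
            (use \<sigma> e3 in \<open>auto simp: B_def fun_eq_iff foldr_conv_fold\<close>)
        have 5: "reg_runs (move_reg w (w + 2) r) ?\<sigma>4 (16 * length ?res + 3) (\<sigma>(r := ?res))"
          by (rule reg_runs_conv[OF reg_runs_move_reg]) (use \<sigma> r in \<open>auto simp: fun_eq_iff\<close>)
        have "reg_runs ?p \<sigma> (?T e) (\<sigma>(r := ?res))"
          by (rule reg_runs_mono[OF reg_runs_Seq[OF 1 reg_runs_Seq[OF 2 reg_runs_Seq[OF 3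
                  reg_runs_Seq[OF 4 5]]]]])
            (use fold_B[of e "f e" "g e"] in \<open>simp add: B_def\<close>)
        then show "reg_runs ?p \<sigma> (?T (\<lambda>i. \<sigma> (\<rho> i))) (\<sigma>(r := foldr (\<lambda>b. S b (\<lambda>i. \<sigma> (\<rho> i)))
          (f (\<lambda>i. \<sigma> (\<rho> i))) (g (\<lambda>i. \<sigma> (\<rho> i)))))" unfolding e_def .
      qed (simp add: computes_ok[OF cf] computes_ok[OF cg] computes_ok[OF cS] loop_def body_def)
      then show ?thesis ..
    qed
  qed
qed

lemma feasible_append:
  assumes "feasible f" "feasible g"
  shows "feasible (\<lambda>e. f e @ g e)"
proof -
  have "feasible (\<lambda>e. foldr (\<lambda>b a. b # a) (f e) (g e))"
    by (rule feasible_foldr[where S = "\<lambda>b _ a. b # a",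
          OF assms feasible_Cons[OF feasible_var] poly_bounded_const[of 1]]) simp
  moreover have "foldr (\<lambda>b a. b # a) x y = x @ y" for x y :: "bool list" by (induction x) auto
  ultimately show ?thesis by simp
qed

lemma feasible_const: "feasible (\<lambda>_. x)"
proof (induction x)
  case (Cons b x)
  then show ?case by (rule feasible_Cons)
qed (rule feasible_Nil)

text \<open>Horner's rule in unary: multiplication by the length of \<open>f e\<close> is a fold
  that prepends the clock of the quotient polynomial once for every bit.\<close>

lemma feasible_clock:
  assumes "feasible f"
  shows "feasible (\<lambda>e. replicate (poly p (length (f e))) True)"
proof (induction p)
  case 0
  show ?case by (simp add: feasible_Nil)
next
  case (pCons a p)
  let ?u = "\<lambda>e. replicate (poly p (length (f e))) True"
  have "feasible (\<lambda>e. foldr (\<lambda>b x. ?u e @ x) (f e) [])"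
    by (rule feasible_foldr[where S = "\<lambda>_ e x. ?u e @ x", OF assms feasible_Nil
          feasible_append[OF feasible_shift[OF pCons.IH] feasible_var] feasible_length[OF pCons.IH]])
      simp
  then have "feasible (\<lambda>e. replicate a True @ foldr (\<lambda>b x. ?u e @ x) (f e) [])"
    by (intro feasible_append feasible_const)
  moreover have "foldr (\<lambda>b x. replicate m True @ x) y [] = replicate (length y * m) True"
    for m and y :: "bool list"
    by (induction y) (simp_all add: replicate_add)
  ultimately show ?case by (simp add: replicate_add)
qed

section \<open>Polynomial-time machines as operations\<close>

lemma feasible_function:
  assumes h: "polytime_computable_on UNIV h" and g: "feasible g"
  shows "feasible (\<lambda>e. h (g e))"
proof -
  obtain M p where M: "wf_tm M" and "computes_in_time M UNIV h (poly p)"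
    using h by (auto simp: polytime_computable_on_def)
  then have "\<forall>x. \<exists>t. t \<le> poly p (length x) \<and> halted M ((step M ^^ t) (initial M x)) \<and>
      hd (snd ((step M ^^ t) (initial M x))) = string_tape (h x)"
    unfolding computes_in_time_def Let_def by blast
  from choice[OF this] obtain time where time: "\<And>x. time x \<le> poly p (length x)"
    "\<And>x. halted M ((step M ^^ time x) (initial M x))"
    "\<And>x. hd (snd ((step M ^^ time x) (initial M x))) = string_tape (h x)"
    by blast
  have h_len: "length (h x) \<le> length x + poly p (length x) + 1" for x
  proof -
    let ?tapes = "snd ((step M ^^ time x) (initial M x))"
    have "length ?tapes = tapes M" "1 \<le> tapes M"
      using wf_config_run[OF M] M by (auto simp: wf_config_def wf_tm_def)
    then have "string_tape (h x) \<in> set ?tapes"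
      using time(3)[of x] by (metis hd_in_set list.size(3) not_one_le_zero)
    then have "length (h x) \<le> Suc (length x + time x)"
      using supported_run[of "time x" M x] by (intro length_le_of_supported) auto
    then show ?thesis using time(1)[of x] by simp
  qed
  obtain T where T: "poly_bounded T" "\<And>\<rho> r w. layout \<rho> r w \<Longrightarrow> \<exists>c. computes c T \<rho> r w g"
    using feasibleE[OF g] by blast
  \<comment> \<open>The clean-up requires strictly more ticks than input length plus running time;
    \<open>q\<close> exceeds their bound by 2 and also bounds the output length.\<close>
  define q where "q = [:2, 1:] + p"
  define clock where "clock e = replicate (poly q (length (g e))) True" for e
  have "feasible clock" unfolding clock_def by (rule feasible_clock[OF g])
  then obtain S where S: "poly_bounded S" "\<And>\<rho> r w. layout \<rho> r w \<Longrightarrow> \<exists>c. computes c S \<rho> r w clock"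
    using feasibleE by blast
  let ?l = "\<lambda>e. poly q (length (g e))"
  let ?T = "\<lambda>e. S e + T e + (?l e + tapes M * (40 * ?l e + 8)) + 21 * ?l e + 10"
  show ?thesis
  proof (rule feasibleI)
    have "poly_bounded (\<lambda>e. length (g e) + poly p (length (g e)) + 1)"
      by (intro poly_bounded_intros feasible_length g)
    then show "poly_bounded (\<lambda>e. length (h (g e)))"
      by (rule poly_bounded_mono) (rule h_len)
    show "poly_bounded ?T"
      by (intro poly_bounded_intros S T feasible_length g)
    show "\<exists>c. computes c ?T \<rho> r w (\<lambda>e. h (g e))" if l: "layout \<rho> r w" for \<rho> r w
    proof -
      have r: "r < w" using layoutD(1)[OF l] .
      have \<rho>: "\<rho> i < w" for i using layoutD(2)[OF l] .
      obtain c where c: "computes c S \<rho> w (w + 1) clock"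
        using S(2)[OF layout_fresh[OF l]] by fastforce
      obtain d where d: "computes d T \<rho> (w + 2) (w + 3) g"
        using T(2)[OF layout_fresh[OF l]] by fastforce
      let ?run = "Seq (Run M (start M) (w + 2) (Halt True) (Halt True))
          (erase_tapes w (w + 1) (Suc (w + 2)) (tapes M - 1))"
      let ?p = "Seq c (Seq d (Seq ?run (Seq (clear w) (move_reg w (w + 2) r))))"
      have "computes ?p ?T \<rho> r w (\<lambda>e. h (g e))"
      proof (rule computesI)
        fix \<sigma> :: env assume \<sigma>: "\<sigma> r = []" "\<And>i. w \<le> i \<Longrightarrow> \<sigma> i = []"
        define e where "e = (\<lambda>i. \<sigma> (\<rho> i))"
        let ?\<sigma>1 = "\<sigma>(w := clock e)"
        let ?\<sigma>2 = "?\<sigma>1(w + 2 := g e)"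
        let ?\<sigma>3 = "?\<sigma>1(w + 2 := h (g e))"
        let ?\<sigma>4 = "\<sigma>(w + 2 := h (g e))"
        have l_ge: "length (g e) + time (g e) + 2 \<le> ?l e"
          using time(1)[of "g e"] by (simp add: q_def)
        have l_ge': "length (h (g e)) \<le> ?l e"
          using h_len[of "g e"] by (simp add: q_def)
        have 1: "reg_runs c \<sigma> (S e) ?\<sigma>1"
          unfolding e_def using \<sigma> by (intro computesD[OF c]) auto
        have e1: "(\<lambda>i. ?\<sigma>1 (\<rho> i)) = e"
          using \<rho> by (auto simp: e_def fun_eq_iff less_imp_neq)
        have 2: "reg_runs d ?\<sigma>1 (T e) ?\<sigma>2"
          using computesD[OF d, of ?\<sigma>1] \<sigma> unfolding e1 by simp
        have "reg_runs ?run ?\<sigma>2 (time (g e) + 2 + tapes M * (40 * ?l e + 8))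
            (?\<sigma>2(w + 2 := h (g e)))"
          by (rule reg_runs_function[OF M]) (use \<sigma> time(2,3) l_ge in \<open>auto simp: clock_def\<close>)
        then have 3: "reg_runs ?run ?\<sigma>2 (time (g e) + 2 + tapes M * (40 * ?l e + 8)) ?\<sigma>3"
          by simp
        have 4: "reg_runs (clear w) ?\<sigma>3 (5 * ?l e + 1) ?\<sigma>4"
          by (rule reg_runs_conv[OF reg_runs_clear]) (use \<sigma> in \<open>auto simp: clock_def fun_eq_iff\<close>)
        have 5: "reg_runs (move_reg w (w + 2) r) ?\<sigma>4 (16 * length (h (g e)) + 3) (\<sigma>(r := h (g e)))"
          by (rule reg_runs_conv[OF reg_runs_move_reg]) (use \<sigma> r in \<open>auto simp: fun_eq_iff\<close>)
        have "reg_runs ?p \<sigma> (?T e) (\<sigma>(r := h (g e)))"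
          by (rule reg_runs_mono[OF reg_runs_Seq[OF 1 reg_runs_Seq[OF 2 reg_runs_Seq[OF 3
                  reg_runs_Seq[OF 4 5]]]]])
            (use l_ge l_ge' in simp)
        then show "reg_runs ?p \<sigma> (?T (\<lambda>i. \<sigma> (\<rho> i))) (\<sigma>(r := h (g (\<lambda>i. \<sigma> (\<rho> i)))))"
          unfolding e_def .
      qed (use c d M in \<open>simp add: computes_ok wf_tm_def\<close>)
      then show ?thesis ..
    qed
  qed
qed

lemma feasible_decider:
  assumes A: "A \<in> class_P" and g: "feasible g"
  shows "feasible (\<lambda>e. [g e \<in> A])"
proof -
  obtain M p where M: "wf_tm M" and "decides_in_time M A (poly p)"
    using A by (auto simp: class_P_def)
  then have "\<forall>x. \<exists>t. t \<le> poly p (length x) \<and>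
      fst ((step M ^^ t) (initial M x)) = (if x \<in> A then accept M else reject M)"
    unfolding decides_in_time_def by blast
  from choice[OF this] obtain time where time: "\<And>x. time x \<le> poly p (length x)"
    "\<And>x. fst ((step M ^^ time x) (initial M x)) = (if x \<in> A then accept M else reject M)"
    by blast
  have acc: "(fst ((step M ^^ time x) (initial M x)) = accept M) = (x \<in> A)" for x
    using time(2)[of x] M by (auto simp: wf_tm_def)
  have halted: "halted M ((step M ^^ time x) (initial M x))" for x
    using time(2)[of x] by (auto simp: halted_def)
  obtain T where T: "poly_bounded T" "\<And>\<rho> r w. layout \<rho> r w \<Longrightarrow> \<exists>c. computes c T \<rho> r w g"
    using feasibleE[OF g] by blast
  define q where "q = [:2, 1:] + p"
  define clock where "clock e = replicate (poly q (length (g e))) True" for e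
  have "feasible clock" unfolding clock_def by (rule feasible_clock[OF g])
  then obtain S where S: "poly_bounded S" "\<And>\<rho> r w. layout \<rho> r w \<Longrightarrow> \<exists>c. computes c S \<rho> r w clock"
    using feasibleE by blast
  let ?l = "\<lambda>e. poly q (length (g e))"
  let ?T = "\<lambda>e. S e + T e + (?l e + tapes M * (40 * ?l e + 8)) + 5 * ?l e + 10"
  show ?thesis
  proof (rule feasibleI)
    show "poly_bounded (\<lambda>e. length [g e \<in> A])"
      using poly_bounded_const[of 1] by simp
    show "poly_bounded ?T"
      by (intro poly_bounded_intros S T feasible_length g)
    show "\<exists>c. computes c ?T \<rho> r w (\<lambda>e. [g e \<in> A])" if l: "layout \<rho> r w" for \<rho> r w
    proof -
      have r: "r < w" using layoutD(1)[OF l] .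
      have \<rho>: "\<rho> i < w" for i using layoutD(2)[OF l] .
      obtain c where c: "computes c S \<rho> w (w + 1) clock"
        using S(2)[OF layout_fresh[OF l]] by fastforce
      obtain d where d: "computes d T \<rho> (w + 2) (w + 3) g"
        using T(2)[OF layout_fresh[OF l]] by fastforce
      let ?run = "Seq (Run M (start M) (w + 2) (push r True) (push r False))
          (erase_tapes w (w + 1) (w + 2) (tapes M))"
      let ?p = "Seq c (Seq d (Seq ?run (clear w)))"
      have "computes ?p ?T \<rho> r w (\<lambda>e. [g e \<in> A])"
      proof (rule computesI)
        fix \<sigma> :: env assume \<sigma>: "\<sigma> r = []" "\<And>i. w \<le> i \<Longrightarrow> \<sigma> i = []"
        define e where "e = (\<lambda>i. \<sigma> (\<rho> i))"
        let ?\<sigma>1 = "\<sigma>(w := clock e)"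
        let ?\<sigma>2 = "?\<sigma>1(w + 2 := g e)"
        let ?\<sigma>3 = "?\<sigma>2(w + 2 := [], r := [g e \<in> A])"
        have l_ge: "length (g e) + time (g e) + 2 \<le> ?l e"
          using time(1)[of "g e"] by (simp add: q_def)
        have 1: "reg_runs c \<sigma> (S e) ?\<sigma>1"
          unfolding e_def using \<sigma> by (intro computesD[OF c]) auto
        have e1: "(\<lambda>i. ?\<sigma>1 (\<rho> i)) = e"
          using \<rho> by (auto simp: e_def fun_eq_iff less_imp_neq)
        have 2: "reg_runs d ?\<sigma>1 (T e) ?\<sigma>2"
          using computesD[OF d, of ?\<sigma>1] \<sigma> unfolding e1 by simp
        have "reg_runs ?run ?\<sigma>2 (time (g e) + 5 + tapes M * (40 * ?l e + 8))
            (?\<sigma>2(w + 2 := [], r := [fst ((step M ^^ time (g e)) (initial M (?\<sigma>2 (w + 2)))) = accept M]))"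
          by (rule reg_runs_decider[OF M]) (use \<sigma> r halted l_ge in \<open>auto simp: clock_def\<close>)
        then have 3: "reg_runs ?run ?\<sigma>2 (time (g e) + 5 + tapes M * (40 * ?l e + 8)) ?\<sigma>3"
          by (simp add: acc)
        have 4: "reg_runs (clear w) ?\<sigma>3 (5 * ?l e + 1) (\<sigma>(r := [g e \<in> A]))"
          by (rule reg_runs_conv[OF reg_runs_clear]) (use \<sigma> r in \<open>auto simp: clock_def fun_eq_iff\<close>)
        have "reg_runs ?p \<sigma> (?T e) (\<sigma>(r := [g e \<in> A]))"
          by (rule reg_runs_mono[OF reg_runs_Seq[OF 1 reg_runs_Seq[OF 2 reg_runs_Seq[OF 3 4]]]])
            (use l_ge in simp)
        then show "reg_runs ?p \<sigma> (?T (\<lambda>i. \<sigma> (\<rho> i))) (\<sigma>(r := [g (\<lambda>i. \<sigma> (\<rho> i)) \<in> A]))"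
          unfolding e_def .
      qed (use c d M in \<open>simp add: computes_ok wf_tm_def\<close>)
      then show ?thesis ..
    qed
  qed
qed

section \<open>From feasible functions to machines\<close>

abbreviation arg :: "bool list \<Rightarrow> env" where
  "arg x \<equiv> case_nat x (\<lambda>_. [])"

lemma feasible_program:
  assumes "feasible f"
  obtains c p where "ok c"
    "\<And>x. reg_runs c (arg x) (poly p (length x)) ((arg x)(2 := f (arg x)))"
    "\<And>x. length (f (arg x)) \<le> poly p (length x)"
proof -
  obtain T where T: "poly_bounded T" "\<And>\<rho> r w. layout \<rho> r w \<Longrightarrow> \<exists>c. computes c T \<rho> r w f"
    using feasibleE[OF assms] by blast
  \<comment> \<open>Register 0 is the input. All other variables share register 1, which stays
    empty, and the result goes to register 2.\<close>
  define \<rho> :: "nat \<Rightarrow> nat" where "\<rho> = case_nat 0 (\<lambda>_. 1)"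
  have "layout \<rho> 2 3" by (auto simp: layout_def \<rho>_def split: nat.split)
  then obtain c where c: "computes c T \<rho> 2 3 f" using T(2) by blast
  obtain p where p: "\<And>x. T (arg x) \<le> poly p (length x)"
    using poly_bounded_unary[OF T(1)] by blast
  obtain q where q: "\<And>x. length (f (arg x)) \<le> poly q (length x)"
    using poly_bounded_unary[OF feasible_length[OF assms]] by blast
  have \<rho>: "(\<lambda>i. (arg x) (\<rho> i)) = arg x" for x
    by (auto simp: fun_eq_iff \<rho>_def split: nat.split)
  have "reg_runs c (arg x) (T (arg x)) ((arg x)(2 := f (arg x)))" for x
    using computesD[OF c, of "arg x"] unfolding \<rho> by (auto split: nat.split)
  moreover have "T (arg x) \<le> poly (p + q) (length x)" "length (f (arg x)) \<le> poly (p + q) (length x)"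
    for x using p[of x] q[of x] by simp_all
  ultimately show thesis
    using computes_ok[OF c] by (intro that[of c "p + q"]) (blast intro: reg_runs_mono)+
qed

lemma input_tapes_eq: "input_tapes x = regs (arg x)"
  by (auto simp: fun_eq_iff input_tapes_def regs_def split: nat.split)

lemma feasible_imp_polytime:
  assumes "feasible f"
  shows "polytime_computable_on UNIV (\<lambda>x. f (arg x))"
proof -
  obtain c p where c: "ok c"
    "\<And>x. reg_runs c (arg x) (poly p (length x)) ((arg x)(2 := f (arg x)))"
    "\<And>x. length (f (arg x)) \<le> poly p (length x)"
    using feasible_program[OF assms] by blast
  let ?d = "Seq c (Seq (clear 0) (move_reg 3 2 0))"
  have "ok ?d" using c(1) by simp
  then obtain M where M: "wf_tm M" "\<And>x n b ts. (prog_step ^^ n) (?d, input_tapes x) = (Halt b, ts) \<Longrightarrow>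
       fst ((step M ^^ n) (initial M x)) = (if b then accept M else reject M) \<and>
       hd (snd ((step M ^^ n) (initial M x))) = ts 0"
    using prog_compile by blast
  define q where "q = p + smult 16 p + [:10, 5:]"
  have "reg_runs ?d (arg x) (poly q (length x)) (arg (f (arg x)))" for x
    by (rule reg_runs_conv[OF reg_runs_Seq[OF c(2) reg_runs_Seq[OF reg_runs_clear reg_runs_move_reg]]])
      (use c(3)[of x] in \<open>auto simp: q_def fun_eq_iff split: nat.split\<close>)
  then have "(prog_step ^^ poly q (length x)) (?d, input_tapes x) =
      (Halt True, regs (arg (f (arg x))))" for x
    by (simp add: reg_runs_def halts_def input_tapes_eq)
  note run = M(2)[OF this]
  have "halted M ((step M ^^ poly q (length x)) (initial M x)) \<and>
      hd (snd ((step M ^^ poly q (length x)) (initial M x))) = string_tape (f (arg x))" for x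
    using run[of x] by (simp add: halted_def regs_def)
  then have "computes_in_time M UNIV (\<lambda>x. f (arg x)) (poly q)"
    unfolding computes_in_time_def Let_def by blast
  then show ?thesis
    using M(1) unfolding polytime_computable_on_def by blast
qed

lemma feasible_imp_class_P:
  assumes "feasible f"
  shows "{x. cond (f (arg x)) False True False} \<in> class_P"
proof -
  obtain c p where c: "ok c"
    "\<And>x. reg_runs c (arg x) (poly p (length x)) ((arg x)(2 := f (arg x)))"
    by (rule feasible_program[OF assms]) blast
  let ?d = "Seq c (Branch 2 (\<lambda>s. s = 2) (Halt True) (Halt False))"
  have "ok ?d" using c(1) by simp
  then obtain M where M: "wf_tm M" "\<And>x n b ts. (prog_step ^^ n) (?d, input_tapes x) = (Halt b, ts) \<Longrightarrow>
       fst ((step M ^^ n) (initial M x)) = (if b then accept M else reject M) \<and>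
       hd (snd ((step M ^^ n) (initial M x))) = ts 0"
    using prog_compile by blast
  define q where "q = p + [:2:]"
  have "halts (cond (f (arg x)) False True False) ?d (input_tapes x) (poly q (length x))
      (regs ((arg x)(2 := f (arg x))))" for x
  proof -
    let ?\<sigma> = "(arg x)(2 := f (arg x))"
    have "(regs ?\<sigma> 2 0 = 2) = cond (f (arg x)) False True False"
      by (simp add: regs_def string_tape_top cond_def blank_def split: list.split)
    then have "halts (cond (f (arg x)) False True False)
        (if regs ?\<sigma> 2 0 = 2 then Halt True else Halt False) (regs ?\<sigma>) 0 (regs ?\<sigma>)"
      using runs_Halt by (cases "regs ?\<sigma> 2 0 = 2") auto
    then have "halts (cond (f (arg x)) False True False)
        (Branch 2 (\<lambda>s. s = 2) (Halt True) (Halt False)) (regs ?\<sigma>) 1 (regs ?\<sigma>)"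
      unfolding One_nat_def by (rule runs_Branch)
    from runs_Seq[OF c(2)[of x, unfolded reg_runs_def] this]
    show ?thesis unfolding input_tapes_eq by (rule runs_mono) (simp add: q_def)
  qed
  then have "(prog_step ^^ poly q (length x)) (?d, input_tapes x) =
      (Halt (cond (f (arg x)) False True False), regs ((arg x)(2 := f (arg x))))" for x
    by (simp add: halts_def)
  note run = M(2)[OF this]
  have "fst ((step M ^^ poly q (length x)) (initial M x)) =
      (if x \<in> {x. cond (f (arg x)) False True False} then accept M else reject M)" for x
    using run[of x] by simp
  then have "decides_in_time M {x. cond (f (arg x)) False True False} (poly q)"
    unfolding decides_in_time_def by blast
  then show ?thesis
    using M(1) unfolding class_P_def by blast
qed

section \<open>Functions on strings\<close>

lemma foldr_const: "foldr (\<lambda>_. g) x a = (g ^^ length x) a"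
  by (induction x) simp_all

lemma feasible_foldr_const:
  assumes "feasible f" "feasible g" "feasible (\<lambda>e. h (e 0))" "\<And>a. length (h a) \<le> Suc (length a)"
  shows "feasible (\<lambda>e. foldr (\<lambda>_. h) (f e) (g e))"
  by (rule feasible_foldr[where S = "\<lambda>_ _. h", OF assms(1-3) poly_bounded_const[of 1]])
    (simp add: assms(4))

lemmas feasible_intros =
  feasible_var feasible_const feasible_Cons feasible_tl feasible_cond feasible_append feasible_decider

section \<open>Decoding pairs\<close>

fun pair_fst :: "bool list \<Rightarrow> bool list" where
  "pair_fst (True # a # w) = a # pair_fst w"
| "pair_fst _ = []"

text \<open>On a string without separator the result is empty, while \<open>pair_fst\<close> still
  collects the blocks. Thus an empty \<open>pair_snd\<close> covers both malformed strings and pairs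
  with an empty second component.\<close>

fun pair_snd :: "bool list \<Rightarrow> bool list" where
  "pair_snd (True # _ # w) = pair_snd w"
| "pair_snd (False # w) = w"
| "pair_snd _ = []"

lemma string_pair_simps [simp]:
  "string_pair [] y = False # y"
  "string_pair (b # x) y = True # b # string_pair x y"
  by (simp_all add: string_pair_def)

lemma pair_fst_string_pair [simp]: "pair_fst (string_pair x y) = x"
  by (induction x) simp_all

lemma pair_snd_string_pair [simp]: "pair_snd (string_pair x y) = y"
  by (induction x) simp_all

lemma length_string_pair [simp]: "length (string_pair x y) = 2 * length x + 1 + length y"
  by (induction x) simp_all

lemma string_pair_append: "string_pair x (y @ z) = string_pair x y @ z"
  by (induction x) simp_all

lemma feasible_string_pair:
  assumes "feasible f" "feasible g"
  shows "feasible (\<lambda>e. string_pair (f e) (g e))"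
proof -
  have "feasible (\<lambda>e. foldr (\<lambda>b a. True # b # a) (f e) (False # g e))"
    by (rule feasible_foldr[where S = "\<lambda>b _ a. True # b # a", OF assms(1) feasible_Cons[OF assms(2)]
          feasible_Cons[OF feasible_Cons[OF feasible_var]] poly_bounded_const[of 2]]) simp
  moreover have "foldr (\<lambda>b a. True # b # a) x (False # y) = string_pair x y" for x y
    by (induction x) simp_all
  ultimately show ?thesis by simp
qed

text \<open>Block boundaries are visible only from the left, but a fold consumes its list from the
  right. Hence the list folded over merely counts iterations, and the word being decoded sits in the
  accumulator.\<close>

definition skip_pair :: "bool list \<Rightarrow> bool list" where
  "skip_pair a = cond a a (tl (tl a)) a"

lemma skip_pair_simps [simp]:
  "skip_pair [] = []" "skip_pair (True # w) = tl w" "skip_pair (False # w) = False # w"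
  by (simp_all add: skip_pair_def)

lemma funpow_fixpoint: "g a = a \<Longrightarrow> (g ^^ n) a = a"
  by (induction n) simp_all

text \<open>A word that starts with its separator is a fixed point of \<open>skip_pair\<close>, and
  so is the empty word. Surplus iterations are harmless, which allows the length of the word as
  their number.\<close>

lemma pair_snd_iterate: "length w \<le> n \<Longrightarrow> pair_snd w = tl ((skip_pair ^^ n) w)"
proof (induction w arbitrary: n rule: pair_snd.induct)
  case (1 a w)
  then obtain m where "n = Suc m" by (cases n) auto
  with 1 show ?case by (simp add: funpow_Suc_right del: funpow.simps)
next
  case (2 w)
  have "(skip_pair ^^ n) (False # w) = False # w" by (rule funpow_fixpoint) simp
  then show ?case by simp
next
  case "3_1"
  have "(skip_pair ^^ n) [] = []" by (rule funpow_fixpoint) simp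
  then show ?case by simp
next
  case "3_2"
  then obtain m where "n = Suc m" by (cases n) auto
  moreover have "(skip_pair ^^ m) [] = []" by (rule funpow_fixpoint) simp
  ultimately show ?case by (simp add: funpow_Suc_right del: funpow.simps)
qed

lemma feasible_skip_pairs:
  assumes "feasible f" "feasible g"
  shows "feasible (\<lambda>e. foldr (\<lambda>_. skip_pair) (f e) (g e))"
proof (rule feasible_foldr_const[OF assms])
  show "feasible (\<lambda>e. skip_pair (e 0))"
    unfolding skip_pair_def by (intro feasible_intros)
  show "length (skip_pair a) \<le> Suc (length a)" for a
    by (auto simp: skip_pair_def cond_def split: list.split)
qed

lemma feasible_pair_snd:
  assumes "feasible f"
  shows "feasible (\<lambda>e. pair_snd (f e))"
proof -
  have "feasible (\<lambda>e. tl (foldr (\<lambda>_. skip_pair) (f e) (f e)))"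
    by (intro feasible_tl feasible_skip_pairs assms)
  then show ?thesis by (simp add: foldr_const pair_snd_iterate[OF order_refl])
qed

text \<open>The bits found so far also count the pairs already read.\<close>

definition pair_fst_step :: "bool list \<Rightarrow> bool list \<Rightarrow> bool list" where
  "pair_fst_step w a = (let v = foldr (\<lambda>_. skip_pair) a w
     in cond v a (cond (tl v) a (a @ [True]) (a @ [False])) a)"

lemma pair_fst_iterate:
  "(skip_pair ^^ length a) w = v \<Longrightarrow> length v \<le> n \<Longrightarrow> (pair_fst_step w ^^ n) a = a @ pair_fst v"
proof (induction v arbitrary: a n rule: pair_fst.induct)
  case (1 b v)
  then obtain m where n: "n = Suc m" by (cases n) auto
  have "pair_fst_step w a = a @ [b]"
    using 1(2) by (cases b) (simp_all add: pair_fst_step_def foldr_const)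
  moreover have "(pair_fst_step w ^^ m) (a @ [b]) = (a @ [b]) @ pair_fst v"
    using 1(2,3) n by (intro 1(1)) simp_all
  ultimately show ?case using n by (simp add: funpow_Suc_right del: funpow.simps)
next
  case ("2_3" b)
  then have "pair_fst_step w a = a"
    by (cases b) (simp_all add: pair_fst_step_def foldr_const)
  then show ?case by (simp add: funpow_fixpoint)
qed (simp_all add: funpow_fixpoint pair_fst_step_def foldr_const)

lemma feasible_pair_fst:
  assumes "feasible f"
  shows "feasible (\<lambda>e. pair_fst (f e))"
proof -
  have "feasible (\<lambda>e. foldr (\<lambda>_. pair_fst_step (f e)) (f e) [])"
  proof (rule feasible_foldr[where S = "\<lambda>_ e. pair_fst_step (f e)", OF assms feasible_Nil])
    show "feasible (\<lambda>e. pair_fst_step (f (\<lambda>i. e (Suc i))) (e 0))"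
      unfolding pair_fst_step_def Let_def
      by (intro feasible_intros feasible_skip_pairs feasible_shift assms)
    show "length (pair_fst_step (f e) a) \<le> length a + 1" for e a
      by (simp add: pair_fst_step_def Let_def cond_def split: list.split)
  qed (rule poly_bounded_const)
  moreover have "(pair_fst_step w ^^ length w) [] = pair_fst w" for w
    using pair_fst_iterate[of "[]" w w] by simp
  ultimately show ?thesis by (simp add: foldr_const)
qed

section \<open>Reversal, padding, dropping and stripping\<close>

lemma feasible_rev:
  assumes "feasible f"
  shows "feasible (\<lambda>e. rev (f e))"
proof -
  have "feasible (\<lambda>e. foldr (\<lambda>b a. a @ [b]) (f e) [])"
    by (rule feasible_foldr[where S = "\<lambda>b _ a. a @ [b]", OF assms feasible_Nil
          feasible_append[OF feasible_var feasible_const] poly_bounded_const[of 1]]) simp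
  moreover have "foldr (\<lambda>b a. a @ [b]) x [] = rev x" for x :: "bool list"
    by (induction x) simp_all
  ultimately show ?thesis by simp
qed

lemma feasible_zeros:
  assumes "feasible f"
  shows "feasible (\<lambda>e. replicate (length (f e)) False)"
proof -
  have "feasible (\<lambda>e. foldr (\<lambda>_. (#) False) (f e) [])"
    by (rule feasible_foldr_const[OF assms feasible_Nil feasible_Cons[OF feasible_var]]) simp
  moreover have "foldr (\<lambda>_. (#) False) x [] = replicate (length x) False" for x :: "bool list"
    by (induction x) simp_all
  ultimately show ?thesis by simp
qed

lemma feasible_drop:
  assumes "feasible f" "feasible g"
  shows "feasible (\<lambda>e. drop (length (f e)) (g e))"
proof -
  have "feasible (\<lambda>e. foldr (\<lambda>_. tl) (f e) (g e))"
    by (rule feasible_foldr_const[OF assms feasible_tl[OF feasible_var]]) simp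
  moreover have "(tl ^^ n) x = drop n x" for n and x :: "bool list"
    by (induction n) (simp_all add: drop_Suc tl_drop)
  ultimately show ?thesis by (simp add: foldr_const)
qed

lemma strip_iterate:
  "length x \<le> n \<Longrightarrow> ((\<lambda>a. cond a a a (tl a)) ^^ n) x = dropWhile Not x"
proof (induction x arbitrary: n)
  case Nil
  show ?case by (simp add: funpow_fixpoint)
next
  case (Cons b x)
  then obtain m where "n = Suc m" by (cases n) auto
  with Cons show ?case
    by (cases b) (simp_all add: funpow_fixpoint funpow_Suc_right del: funpow.simps)
qed

lemma feasible_strip:
  assumes "feasible f"
  shows "feasible (\<lambda>e. dropWhile Not (f e))"
proof -
  have "feasible (\<lambda>e. foldr (\<lambda>_ a. cond a a a (tl a)) (f e) (f e))"
  proof (rule feasible_foldr_const[OF assms assms])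
    show "feasible (\<lambda>e. cond (e 0) (e 0) (e 0) (tl (e 0)))"
      by (intro feasible_intros)
    show "length (cond a a a (tl a)) \<le> Suc (length a)" for a :: "bool list"
      by (simp add: cond_def split: list.split)
  qed
  then show ?thesis by (simp add: foldr_const strip_iterate)
qed

section \<open>Binary numbers and the length-lexicographic order\<close>

fun val :: "bool list \<Rightarrow> nat" where
  "val [] = 0"
| "val (b # x) = (if b then 2 ^ length x else 0) + val x"

lemma val_less: "val x < 2 ^ length x"
  by (induction x) auto

lemma val_append: "val (x @ y) = val x * 2 ^ length y + val y"
  by (induction x) (simp_all add: power_add algebra_simps)

lemma val_replicate_False [simp]: "val (replicate n False) = 0"
  by (induction n) simp_all

lemma val_replicate_True: "Suc (val (replicate n True)) = 2 ^ n"
  by (induction n) simp_all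

lemma val_inj: "length x = length y \<Longrightarrow> val x = val y \<Longrightarrow> x = y"
proof (induction x y rule: list_induct2)
  case (Cons a x b y)
  then show ?case using val_less[of x] val_less[of y] by (auto split: if_splits)
qed simp

text \<open>The leading 1 makes the length decisive. In this way \<open>val (True # x)\<close> will
  be the position of \<open>x\<close> in the length-lexicographic enumeration of all strings,
  starting from 1 for the empty string.\<close>

lemma val_less_of_shorter: "length x < length y \<Longrightarrow> val (True # x) < val (True # y)"
proof -
  assume "length x < length y"
  then have "(2::nat) ^ Suc (length x) \<le> 2 ^ length y" by (intro power_increasing) auto
  then show ?thesis using val_less[of x] by simp
qed

lemma val_True_inj: "val (True # x) = val (True # y) \<longleftrightarrow> x = y"
  using val_less_of_shorter[of x y] val_less_of_shorter[of y x] val_inj[of "True # x" "True # y"]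
  by (metis list.inject length_Cons linorder_neqE_nat nat_neq_iff)

lemma val_less_length: "val (True # x) < val (True # y) \<Longrightarrow> length x \<le> length y"
  using val_less_of_shorter[of y x] by fastforce

lemma ex_val:
  assumes "v < 2 ^ n" obtains x where "length x = n" "val x = v"
  using assms
proof (induction n arbitrary: v thesis)
  case (Suc n)
  show ?case
  proof (cases "v < 2 ^ n")
    case True
    then obtain x where "length x = n" "val x = v" using Suc.IH by blast
    then show ?thesis using Suc.prems(1)[of "False # x"] by simp
  next
    case False
    then have "v - 2 ^ n < 2 ^ n" using Suc.prems(2) by simp
    then obtain x where "length x = n" "val x = v - 2 ^ n" using Suc.IH by blast
    then show ?thesis using Suc.prems(1)[of "True # x"] False by simp
  qed
qed simp

lemma ex_val_True:
  assumes "0 < v" obtains x where "val (True # x) = v"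
proof -
  obtain n where "2 ^ n \<le> v" "v < 2 ^ Suc n"
    using assms ex_power_ivl1[of 2 v] by auto
  then have "v - 2 ^ n < 2 ^ n" by simp
  then obtain x where "length x = n" "val x = v - 2 ^ n" by (rule ex_val)
  then show thesis using that[of x] \<open>2 ^ n \<le> v\<close> by simp
qed

lemma card_val: "card {x. length x = n \<and> P (val x)} = card {v. v < 2 ^ n \<and> P v}"
proof (rule bij_betw_same_card)
  show "bij_betw val {x. length x = n \<and> P (val x)} {v. v < 2 ^ n \<and> P v}"
    unfolding bij_betw_def
  proof
    show "inj_on val {x. length x = n \<and> P (val x)}" by (auto intro!: inj_onI val_inj)
    show "val ` {x. length x = n \<and> P (val x)} = {v. v < 2 ^ n \<and> P v}"
      using val_less by (auto simp: image_iff) (metis ex_val)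
  qed
qed

lemma card_length: "card {x :: bool list. length x = n} = 2 ^ n"
  using card_val[of n "\<lambda>_. True"] by simp

lemma card_val_True: "card {x. P (val (True # x))} = card {v. 0 < v \<and> P v}"
proof (rule bij_betw_same_card)
  show "bij_betw (\<lambda>x. val (True # x)) {x. P (val (True # x))} {v. 0 < v \<and> P v}"
    unfolding bij_betw_def
  proof
    show "inj_on (\<lambda>x. val (True # x)) {x. P (val (True # x))}"
      by (rule inj_onI) (simp only: val_True_inj)
    show "(\<lambda>x. val (True # x)) ` {x. P (val (True # x))} = {v. 0 < v \<and> P v}"
      by (auto simp: image_iff) (metis ex_val_True val.simps(2))
  qed
qed

lemma lenlex_val:
  "length y = length x \<Longrightarrow> (y, x) \<in> lenlex {(a, b). a < b} \<longleftrightarrow> val y < val x"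
proof (induction y x rule: list_induct2)
  case (Cons a y b x)
  then show ?case using val_less[of x] val_less[of y]
    by (cases a; cases b) (auto simp: Cons_lenlex_iff)
qed simp

lemma lex_le_val: "lex_le y x \<longleftrightarrow> val (True # y) \<le> val (True # x)"
proof -
  consider "length y < length x" | "length x < length y" | "length y = length x" by linarith
  then have "(y, x) \<in> lenlex {(a, b). a < b} \<longleftrightarrow> val (True # y) < val (True # x)"
  proof cases
    case 1
    then show ?thesis using val_less_of_shorter[of y x] by (simp add: lenlex_conv del: val.simps)
  next
    case 2
    then show ?thesis using val_less_of_shorter[of x y] lenlex_length[of y x] by fastforce
  next
    case 3
    then show ?thesis using lenlex_val[OF 3] by simp
  qed
  then show ?thesis
    unfolding lex_le_def val_True_inj[of y x, symmetric] by linarith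
qed

lemma ranking_val: "ranking A x = card {y. val (True # y) \<le> val (True # x) \<and> y \<in> A}"
  by (simp only: ranking_def lex_le_val)

lemma finite_val_le: "finite {y. val (True # y) \<le> n \<and> Q y}"
proof -
  have "inj_on (\<lambda>y. val (True # y)) {y. val (True # y) \<le> n \<and> Q y}"
    by (rule inj_onI) (simp only: val_True_inj)
  moreover have "finite ((\<lambda>y. val (True # y)) ` {y. val (True # y) \<le> n \<and> Q y})"
    by (rule finite_subset[of _ "{..n}"]) auto
  ultimately show ?thesis using finite_imageD by blast
qed

lemma val_snoc: "val (x @ [b]) = 2 * val x + of_bool b"
  by (simp add: val_append)

text \<open>The induction appends bits at the end because \<open>binary\<close> splits off the least
  significant bit.\<close>

lemma binary_val_True: "binary (val (True # x)) = True # x"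
proof (induction x rule: rev_induct)
  case Nil
  show ?case by (simp add: binary.simps)
next
  case (snoc b x)
  have "val (True # x @ [b]) = 2 * val (True # x) + of_bool b"
    using val_snoc[of "True # x" b] by simp
  moreover have "val (True # x) \<ge> 1" by (simp add: Suc_le_eq)
  ultimately show ?case
    using snoc.IH by (subst binary.simps) (cases b; simp del: val.simps)
qed

lemma val_strip: "val (dropWhile Not x) = val x"
  by (induction x) simp_all

lemma strip_cases:
  obtains "dropWhile Not x = []" | y where "dropWhile Not x = True # y"
proof (cases "dropWhile Not x")
  case (Cons b y)
  then have b by (metis dropWhile_eq_Cons_conv)
  with Cons show thesis by (intro that(2)[of y]) simp
qed (rule that(1))

text \<open>Converts the result of the binary search, which has leading zeros, into canonical
  notation. Zero needs its own case: stripping leaves nothing of it, but \<open>binary 0\<close> is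
  \<open>[False]\<close>.\<close>

lemma binary_val:
  "binary (val x) = cond (dropWhile Not x) [False] (dropWhile Not x) []"
proof (cases rule: strip_cases[of x])
  case 1
  then have "val x = 0" using val_strip[of x] by (metis val.simps(1))
  then show ?thesis unfolding 1 by (simp add: binary.simps)
next
  case (2 y)
  then have "val x = val (True # y)" using val_strip[of x] by simp
  then show ?thesis using 2 by (simp only: binary_val_True) simp
qed

text \<open>
  Comparison from the least significant bit on. The accumulator consists of the result so far and
  the remaining bits of the second number, which may be the shorter one.
\<close>

definition compare_step :: "bool \<Rightarrow> bool list \<Rightarrow> bool list" where
  "compare_step b a =
     (let rest = tl (tl a); keep = cond a [] (True # rest) (False # rest)
      in if b then cond (tl a) [True] keep (True # rest)
         else cond (tl a) keep (False # rest) keep)"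

text \<open>Here \<open>k\<close> has its least significant bit first, and bits beyond its end count
  as 0. The initial flag \<open>c\<close> decides ties, so \<open>True\<close> yields the non-strict
  and \<open>False\<close> the strict comparison of \<open>k\<close> with \<open>x\<close>.\<close>

lemma foldr_compare_step:
  "foldr compare_step x (c # k) =
     (let v = val (rev (take (length x) k)) in v < val x \<or> v = val x \<and> c) # drop (length x) k"
proof (induction x)
  case (Cons b x)
  have less: "val (rev (take (length x) k)) < 2 ^ length x"
  proof -
    have "val (rev (take (length x) k)) < 2 ^ length (rev (take (length x) k))" by (rule val_less)
    also have "\<dots> \<le> 2 ^ length x" by (intro power_increasing) auto
    finally show ?thesis .
  qed
  have x: "val x < 2 ^ length x" by (rule val_less)
  show ?case
  proof (cases "drop (length x) k")
    case Nil
    then have "take (Suc (length x)) k = take (length x) k" by simp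
    then show ?thesis
      using Cons Nil x less by (cases b) (auto simp: compare_step_def Let_def cond_def)
  next
    case (Cons d k')
    then have l: "length x < length k" by (metis drop_eq_Nil linorder_not_less list.distinct(1))
    have t: "take (Suc (length x)) k = take (length x) k @ [d]"
      using Cons l by (metis nth_via_drop take_Suc_conv_app_nth)
    have d: "drop (Suc (length x)) k = k'"
      using Cons by (metis drop_Suc list.sel(3) tl_drop)
    show ?thesis
      using Cons.IH Cons t d l x less
      by (cases b; cases d) (auto simp: compare_step_def Let_def cond_def min_def)
  qed
qed simp

definition compare_bits :: "bool \<Rightarrow> bool list \<Rightarrow> bool list \<Rightarrow> bool list" where
  "compare_bits c x k = foldr compare_step x (c # rev k)"

lemma cond_compare_bits:
  assumes "length k \<le> length x"
  shows "cond (compare_bits c x k) p q r = (if val k < val x \<or> val k = val x \<and> c then q else r)"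
  using assms by (simp add: compare_bits_def foldr_compare_step Let_def cond_def)

lemma feasible_compare_bits:
  assumes "feasible f" "feasible g"
  shows "feasible (\<lambda>e. compare_bits c (f e) (g e))"
  unfolding compare_bits_def
proof (rule feasible_foldr[where S = "\<lambda>b _. compare_step b", OF assms(1)])
  show "feasible (\<lambda>e. c # rev (g e))" by (intro feasible_intros feasible_rev assms)
  show "feasible (\<lambda>e. compare_step b (e 0))" for b
    unfolding compare_step_def Let_def by (cases b) (simp_all, (intro feasible_intros)+)
  show "poly_bounded (\<lambda>_. 1)" by (rule poly_bounded_const)
  show "length (compare_step b a) \<le> length a + 1" for b a
    by (auto simp: compare_step_def Let_def cond_def split: list.split)
qed

section \<open>PP and ranking\<close>

lemma class_P_subset_class_PP: "class_P \<subseteq> class_PP"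
proof
  fix A assume A: "A \<in> class_P"
  have "feasible (\<lambda>e. [pair_fst (e 0) \<in> A])"
    by (intro feasible_decider A feasible_pair_fst feasible_var)
  from feasible_imp_class_P[OF this] have B: "{w. pair_fst w \<in> A} \<in> class_P"
    by (simp add: cond_def if_bool_eq_conj)
  \<comment> \<open>For the polynomial 0 the empty string is the only candidate and the threshold is
    \<open>2 ^ (0 - 1) = 1\<close>, so this candidate alone decides.\<close>
  have "x \<in> A \<longleftrightarrow> card {y. length y = poly 0 (length x) \<and> string_pair x y \<in> {w. pair_fst w \<in> A}}
      \<ge> 2 ^ (poly 0 (length x) - 1)" for x
    by (cases "x \<in> A") simp_all
  then show "A \<in> class_PP"
    unfolding class_PP_def by (intro CollectI bexI[OF _ B] exI[of _ 0] allI)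
qed

text \<open>The verifier for \<open>w\<close> = <<X, k>, bs>, where X will be 1x. For b = 1 the
  candidate is a trivial witness, namely if \<open>val k \<le> val s\<close>. For b = 0 the string
  \<open>s\<close> has to be 1y padded with zeros, and it is a witness if its value is at most
  \<open>val X\<close> and \<open>y\<close> is in \<open>A\<close>.\<close>

definition count_test :: "bool list set \<Rightarrow> bool list \<Rightarrow> bool list" where
  "count_test A w =
     (let s = tl (pair_snd w); d = dropWhile Not s in
      cond (pair_snd w) []
        (compare_bits True s (pair_snd (pair_fst w)))
        (cond (compare_bits False s (pair_fst (pair_fst w))) [] []
          (cond d [] [tl d \<in> A] [])))"

definition count_set :: "bool list set \<Rightarrow> bool list set" where
  "count_set A = {w. cond (count_test A w) False True False}"

lemma count_set_in_P:
  assumes "A \<in> class_P" shows "count_set A \<in> class_P"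
proof -
  have "feasible (\<lambda>e. count_test A (e 0))"
    unfolding count_test_def Let_def
    by (intro feasible_intros feasible_compare_bits feasible_strip feasible_pair_fst
        feasible_pair_snd assms)
  from feasible_imp_class_P[OF this] show ?thesis by (simp add: count_set_def)
qed

lemma count_set_True:
  assumes "length k \<le> length s"
  shows "string_pair (string_pair X k) (True # s) \<in> count_set A \<longleftrightarrow> val k \<le> val s"
  using cond_compare_bits[OF assms, of True False True False]
  by (auto simp: count_set_def count_test_def)

lemma count_set_False:
  assumes "length X \<le> length s"
  shows "string_pair (string_pair X k) (False # s) \<in> count_set A \<longleftrightarrow>
    val s \<le> val X \<and> (\<exists>y \<in> A. dropWhile Not s = True # y)"
proof -
  define d where "d = dropWhile Not s"
  have "string_pair (string_pair X k) (False # s) \<in> count_set A \<longleftrightarrow>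
      cond (if val X < val s then [] else cond d [] [tl d \<in> A] []) False True False"
    by (simp add: count_set_def count_test_def Let_def cond_compare_bits[OF assms] flip: d_def)
  also have "\<dots> \<longleftrightarrow> val s \<le> val X \<and> (\<exists>y \<in> A. d = True # y)"
    by (auto simp: cond_def split: list.split)
  finally show ?thesis unfolding d_def .
qed

lemma strip_pad: "dropWhile Not (replicate n False @ True # y) = True # y"
  by (induction n) simp_all

lemma strip_eqD: "dropWhile Not s = True # y \<Longrightarrow> \<exists>k. s = replicate k False @ True # y"
proof (induction s)
  case (Cons b s)
  show ?case
  proof (cases b)
    case True
    then show ?thesis using Cons.prems by (intro exI[of _ 0]) simp
  next
    case False
    then obtain k where "s = replicate k False @ True # y" using Cons by auto
    with False show ?thesis by (intro exI[of _ "Suc k"]) simp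
  qed
qed simp

text \<open>PP candidates all have the same length, while the strings up to \<open>x\<close> do not.
  Padding 1y with leading zeros to length \<open>m\<close> keeps its value, and stripping the zeros
  recovers \<open>y\<close>.\<close>

lemma card_padded:
  assumes "length x < m"
  shows "card {s. length s = m \<and> val s \<le> val (True # x) \<and> (\<exists>y \<in> A. dropWhile Not s = True # y)} =
    ranking A x"
  unfolding ranking_val
proof (rule bij_betw_same_card)
  let ?pad = "\<lambda>y. replicate (m - Suc (length y)) False @ True # y"
  let ?S = "{s. length s = m \<and> val s \<le> val (True # x) \<and> (\<exists>y \<in> A. dropWhile Not s = True # y)}"
  let ?R = "{y. val (True # y) \<le> val (True # x) \<and> y \<in> A}"
  have strip: "val s = val (True # y)" if "dropWhile Not s = True # y" for s y
    using that val_strip[of s] by metis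
  have len: "length y < m" if "val (True # y) \<le> val (True # x)" for y
    using that assms val_less_of_shorter[of x y] by linarith
  show "bij_betw (\<lambda>s. tl (dropWhile Not s)) ?S ?R"
  proof (rule bij_betw_byWitness[where f' = ?pad])
    show "\<forall>s \<in> ?S. ?pad (tl (dropWhile Not s)) = s"
      by (auto dest!: strip_eqD simp: strip_pad)
    show "\<forall>y \<in> ?R. tl (dropWhile Not (?pad y)) = y"
      by (simp add: strip_pad)
    show "(\<lambda>s. tl (dropWhile Not s)) ` ?S \<subseteq> ?R"
    proof (rule image_subsetI)
      fix s assume s: "s \<in> ?S"
      then obtain y where y: "y \<in> A" "dropWhile Not s = True # y" by blast
      show "tl (dropWhile Not s) \<in> ?R"
        using s y(1) strip[OF y(2)] by (simp add: y(2) del: val.simps)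
    qed
    show "?pad ` ?R \<subseteq> ?S"
    proof (rule image_subsetI)
      fix y assume y: "y \<in> ?R"
      then have "length y < m" using len by blast
      then show "?pad y \<in> ?S"
        using y by (auto simp: strip_pad val_append simp del: val.simps)
    qed
  qed
qed

text \<open>A candidate is a selector bit followed by \<open>length z\<close> bits, so half of all
  candidates are \<open>2 ^ length z\<close>. For \<open>z\<close> = <1x, k>, that many bits have
  room for both \<open>val k\<close> and \<open>val (True # x)\<close>.\<close>

definition rank_query :: "bool list set \<Rightarrow> bool list set" where
  "rank_query A = {z. card {y. length y = 1 + length z \<and> string_pair z y \<in> count_set A} \<ge> 2 ^ length z}"

lemma rank_query_in_PP: "A \<in> class_P \<Longrightarrow> rank_query A \<in> class_PP"
  unfolding class_PP_def
  by (rule CollectI, rule bexI[OF _ count_set_in_P], rule exI[of _ "[:1, 1:]"])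
    (simp_all add: rank_query_def)

text \<open>
  Among the \<open>y\<close> with first bit 1 there are \<open>2^m - val k\<close> witnesses, among those with first bit 0
  there are \<open>ranking A x\<close>.
\<close>

lemma rank_query_iff:
  assumes k: "length k = Suc (length x)"
  shows "string_pair (True # x) k \<in> rank_query A \<longleftrightarrow> val k \<le> ranking A x"
proof -
  define z where "z = string_pair (True # x) k"
  define m where "m = length z"
  have m: "length k \<le> m" "length x < m" "length (True # x) \<le> m" using k by (simp_all add: m_def z_def)
  let ?S = "{s. length s = m \<and> val k \<le> val s}"
  let ?R = "{s. length s = m \<and> val s \<le> val (True # x) \<and> (\<exists>y \<in> A. dropWhile Not s = True # y)}"
  have fin: "finite {s :: bool list. length s = m \<and> P s}" for P
    by (rule finite_subset[OF _ finite_lists_length_eq[of UNIV m]]) auto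
  have "{y. length y = 1 + m \<and> string_pair z y \<in> count_set A} = (#) True ` ?S \<union> (#) False ` ?R"
  proof (intro set_eqI)
    fix y
    show "y \<in> {y. length y = 1 + m \<and> string_pair z y \<in> count_set A} \<longleftrightarrow>
        y \<in> (#) True ` ?S \<union> (#) False ` ?R"
    proof (cases y)
      case (Cons b s)
      then show ?thesis
        using count_set_True[of k s "True # x" A] count_set_False[of "True # x" s k A] m
        by (cases b) (auto simp: z_def simp del: val.simps)
    qed auto
  qed
  then have "card {y. length y = 1 + m \<and> string_pair z y \<in> count_set A} =
      card ((#) True ` ?S) + card ((#) False ` ?R)"
    by (simp only:) (intro card_Un_disjoint finite_imageI fin; auto)
  also have "\<dots> = card ?S + card ?R"
    by (simp add: card_image)
  also have "card ?S = 2 ^ m - val k"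
  proof -
    have "card ?S = card {val k..<2 ^ m}"
      unfolding card_val by (rule arg_cong[where f = card]) auto
    then show ?thesis by simp
  qed
  also have "card ?R = ranking A x" by (rule card_padded[OF m(2)])
  finally have "z \<in> rank_query A \<longleftrightarrow> 2 ^ m \<le> 2 ^ m - val k + ranking A x"
    by (simp add: rank_query_def m_def)
  moreover have "val k < 2 ^ m"
    by (rule less_le_trans[OF val_less power_increasing[OF m(1)]]) simp
  ultimately show ?thesis unfolding z_def by linarith
qed

text \<open>The rank is at most the position \<open>val (True # x)\<close> among all strings.
  Therefore the binary search has to find \<open>length x + 1\<close> bits.\<close>

lemma ranking_less: "ranking A x < 2 ^ Suc (length x)"
proof -
  have "ranking A x \<le> card {y. val (True # y) \<le> val (True # x)}"
    unfolding ranking_val using finite_val_le[of "val (True # x)" "\<lambda>_. True"]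
    by (intro card_mono) (auto simp del: val.simps)
  also have "\<dots> = card {v. 0 < v \<and> v \<le> val (True # x)}" by (rule card_val_True)
  also have "{v. 0 < v \<and> v \<le> val (True # x)} = {0<..val (True # x)}" by auto
  also have "card \<dots> = val (True # x)" by simp
  also have "\<dots> < 2 ^ length (True # x)" by (rule val_less)
  finally show ?thesis by simp
qed

text \<open>\<open>a\<close> consists of the leading bits found so far, and the query asks whether
  the next one can be 1. The string \<open>drop (length a) x\<close> only supplies the length of the
  padding, which brings the queried number to \<open>length x + 1\<close> bits.\<close>

definition search_step :: "bool list set \<Rightarrow> bool list \<Rightarrow> bool list \<Rightarrow> bool list" where
  "search_step Q x a = a @
     [string_pair (True # x) (a @ True # replicate (length (drop (length a) x)) False) \<in> Q]"

lemma binary_search: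
  assumes Q: "\<And>k. length k = Suc (length x) \<Longrightarrow> string_pair (True # x) k \<in> Q \<longleftrightarrow> val k \<le> R"
    and R: "R < 2 ^ Suc (length x)"
  shows "val ((search_step Q x ^^ Suc (length x)) []) = R"
proof -
  define n where "n = Suc (length x)"
  \<comment> \<open>The invariant confines \<open>R\<close> to an interval of
    \<open>2 ^ (n - j)\<close> numbers, hence to a single one when \<open>j = n\<close>.\<close>
  have "length a = j \<and> val a * 2 ^ (n - j) \<le> R \<and> R < (val a + 1) * 2 ^ (n - j)"
    if "j \<le> n" "a = (search_step Q x ^^ j) []" for j a
    using that
  proof (induction j arbitrary: a)
    case 0
    then show ?case using R by (simp add: n_def)
  next
    case (Suc j)
    define c where "c = (search_step Q x ^^ j) []"
    define r where "r = n - Suc j"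
    have j: "n - j = Suc r" "length x - j = r" using Suc.prems(1) by (auto simp: r_def n_def)
    have IH: "length c = j" "val c * (2 * 2 ^ r) \<le> R" "R < (val c + 1) * (2 * 2 ^ r)"
      using Suc.IH[OF _ c_def] Suc.prems(1) j by auto
    let ?k = "c @ True # replicate r False"
    have "length ?k = Suc (length x)" using IH(1) Suc.prems(1) by (simp add: r_def n_def)
    from Q[OF this] have "string_pair (True # x) ?k \<in> Q \<longleftrightarrow> (2 * val c + 1) * 2 ^ r \<le> R"
      by (simp add: val_append algebra_simps)
    moreover have "a = c @ [string_pair (True # x) ?k \<in> Q]"
    proof -
      have "a = search_step Q x c" using Suc.prems(2) by (simp add: c_def)
      then show ?thesis unfolding search_step_def using IH(1) j by simp
    qed
    ultimately show ?case
      using IH by (auto simp: val_snoc r_def[symmetric] algebra_simps)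
  qed
  from this[of n] show ?thesis by (simp add: n_def)
qed

lemma rankable_of_PP_subset_P:
  assumes "class_PP \<subseteq> class_P" "A \<in> class_P"
  shows "rankable A"
proof -
  let ?Q = "rank_query A"
  have Q: "?Q \<in> class_P" using assms rank_query_in_PP by blast
  \<comment> \<open>The list \<open>True # e 0\<close> serves as the counter for one round per bit
    of the rank.\<close>
  let ?K = "\<lambda>e. foldr (\<lambda>_. search_step ?Q (e 0)) (True # e 0) []"
  have K: "feasible ?K"
  proof (rule feasible_foldr[where S = "\<lambda>_ e. search_step ?Q (e 0)" and D = "\<lambda>_. 1"])
    show "feasible (\<lambda>e. search_step ?Q (e (Suc 0)) (e 0))"
      unfolding search_step_def
      by (intro feasible_intros feasible_string_pair feasible_zeros feasible_drop Q)
    show "length (search_step ?Q (e 0) a) \<le> length a + 1" for e :: env and a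
      by (simp add: search_step_def)
  qed (intro feasible_intros feasible_Nil poly_bounded_const)+
  have "?K (arg x) = (search_step ?Q x ^^ Suc (length x)) []" for x
    by (simp add: foldr_const)
  then have val: "val (?K (arg x)) = ranking A x" for x
    using binary_search[of x ?Q "ranking A x", OF rank_query_iff ranking_less] by metis
  have *: "binary (ranking A x) =
      cond (dropWhile Not (?K (arg x))) [False] (dropWhile Not (?K (arg x))) []" for x
    unfolding val[symmetric] by (rule binary_val)
  have "feasible (\<lambda>e. cond (dropWhile Not (?K e)) [False] (dropWhile Not (?K e)) [])"
    by (intro feasible_cond feasible_strip K feasible_const)
  from feasible_imp_polytime[OF this] show ?thesis
    unfolding rankable_def * .
qed

section \<open>Deciding PP by ranking a balanced set\<close>

text \<open>Strings that do not have the form \<open>\<langle>x, by\<rangle>\<close> are split evenly by their last bit.\<close>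

definition balanced :: "bool list set \<Rightarrow> bool list set" where
  "balanced A = {w. case pair_snd w of
       [] \<Rightarrow> w = [] \<or> \<not> last w
     | b # y \<Rightarrow> b = (string_pair (pair_fst w) y \<notin> A)}"

lemma balanced_in_P:
  assumes A: "A \<in> class_P" shows "balanced A \<in> class_P"
proof -
  let ?in = "\<lambda>e. [string_pair (pair_fst (e 0)) (tl (pair_snd (e 0))) \<in> A]"
  let ?f = "\<lambda>e :: env. cond (pair_snd (e 0)) (cond (rev (e 0)) [True] [False] [True])
    (cond (?in e) [] [False] [True]) (?in e)"
  have "feasible ?f"
    by (intro feasible_intros feasible_rev feasible_string_pair feasible_pair_fst feasible_pair_snd A)
  from feasible_imp_class_P[OF this] have "{w. cond (?f (arg w)) False True False} \<in> class_P" .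
  also have "{w. cond (?f (arg w)) False True False} = balanced A"
  proof (intro set_eqI)
    fix w :: "bool list"
    show "w \<in> {w. cond (?f (arg w)) False True False} \<longleftrightarrow> w \<in> balanced A"
    proof (cases "pair_snd w")
      case Nil
      then show ?thesis
        by (cases w rule: rev_cases) (simp_all add: balanced_def cond_def)
    next
      case (Cons b y)
      then show ?thesis
        by (cases b) (simp_all add: balanced_def cond_def)
    qed
  qed
  finally show ?thesis .
qed

text \<open>Where no bit follows a separator, the last bit is flipped instead. This may turn a final
  separator into a 1 or back, but it never creates a bit behind a separator, so such strings remain
  among themselves.\<close>

fun flip :: "bool list \<Rightarrow> bool list" where
  "flip (False # b # w) = False # (\<not> b) # w"
| "flip (True # a # b # w) = True # a # flip (b # w)"
| "flip [True, a] = [True, \<not> a]"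
| "flip [b] = [\<not> b]"
| "flip [] = []"

lemma length_flip [simp]: "length (flip w) = length w"
  by (induction w rule: flip.induct) simp_all

lemma flip_eq_Nil [simp]: "flip w = [] \<longleftrightarrow> w = []"
  using length_flip[of w] by (metis length_0_conv)

lemma flip_True: "w \<noteq> [] \<Longrightarrow> flip (True # a # w) = True # a # flip w"
  by (cases w) simp_all

lemma flip_flip [simp]: "flip (flip w) = w"
  by (induction w rule: flip.induct) (simp_all add: flip_True)

lemma pair_snd_flip:
  "pair_snd (flip w) = (case pair_snd w of [] \<Rightarrow> [] | b # y \<Rightarrow> (\<not> b) # y)"
proof (induction w rule: flip.induct)
  case (4 b)
  then show ?case by (cases b) simp_all
qed simp_all

lemma pair_fst_flip: "pair_snd w \<noteq> [] \<Longrightarrow> pair_fst (flip w) = pair_fst w"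
proof (induction w rule: flip.induct)
  case (4 b)
  then show ?case by (cases b) simp_all
qed simp_all

lemma last_flip: "pair_snd w = [] \<Longrightarrow> w \<noteq> [] \<Longrightarrow> last (flip w) = (\<not> last w)"
  by (induction w rule: flip.induct) simp_all

text \<open>On <x, by> the flip negates \<open>b\<close>, while the value that
  \<open>balanced\<close> compares it with depends on \<open>x\<close> and \<open>y\<close> only. On
  the other nonempty strings it negates the last bit, which decides there.\<close>

lemma flip_in_balanced: "w \<noteq> [] \<Longrightarrow> flip w \<in> balanced A \<longleftrightarrow> w \<notin> balanced A"
  by (cases "pair_snd w")
    (simp_all add: balanced_def pair_snd_flip pair_fst_flip last_flip)

lemma card_balanced:
  assumes "finite S" "[] \<notin> S" "flip ` S \<subseteq> S"
  shows "2 * card (S \<inter> balanced A) = card S"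
proof -
  have "bij_betw flip (S \<inter> balanced A) (S - balanced A)"
  proof (rule bij_betw_byWitness[where f' = flip])
    show "flip ` (S \<inter> balanced A) \<subseteq> S - balanced A"
      using assms by (auto simp: image_subset_iff) (metis flip_in_balanced)
    show "flip ` (S - balanced A) \<subseteq> S \<inter> balanced A"
      using assms by (auto simp: image_subset_iff) (metis flip_in_balanced)
  qed simp_all
  then have "card (S \<inter> balanced A) = card (S - balanced A)" by (rule bij_betw_same_card)
  moreover have "card (S \<inter> balanced A) + card (S - balanced A) = card S"
    using assms(1) by (simp add: card_Diff_subset_Int card_mono)
  ultimately show ?thesis by simp
qed

text \<open>The empty string has no partner under \<open>flip\<close>. Its membership makes the
  census formula hold at length 0 and supplies the one element that completes the count in
  \<open>ranking_balanced\<close>.\<close>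

lemma Nil_in_balanced [simp]: "[] \<in> balanced A"
  by (simp add: balanced_def)

lemma census_balanced: "census (balanced A) n = 2 ^ (n - 1)"
proof (cases n)
  case 0
  have "{x \<in> balanced A. length x = 0} = {[]}" by auto
  then show ?thesis using 0 by (simp add: census_def)
next
  case (Suc m)
  let ?S = "{x :: bool list. length x = n}"
  have "finite ?S" using finite_lists_length_eq[of "UNIV :: bool set" n] by simp
  moreover have "[] \<notin> ?S" using Suc by auto
  ultimately have "2 * card (?S \<inter> balanced A) = 2 ^ n"
    unfolding card_length[symmetric] by (intro card_balanced) auto
  moreover have "?S \<inter> balanced A = {x \<in> balanced A. length x = n}" by auto
  ultimately show ?thesis using Suc by (simp add: census_def)
qed

lemma polytime_census_balanced: "polytime_census (balanced A)"
proof -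
  have "feasible (\<lambda>e. True # replicate (length (tl (e 0))) False)"
    by (intro feasible_intros feasible_zeros)
  from feasible_imp_polytime[OF this]
  have *: "polytime_computable_on UNIV (\<lambda>x. True # replicate (length x - 1) False)" by simp
  \<comment> \<open>This includes \<open>n = 0\<close>, where truncated subtraction gives 1 on both
    sides.\<close>
  have "binary (census (balanced A) n) = True # replicate (n - 1) False" for n
    using binary_val_True[of "replicate (n - 1) False"] by (simp add: census_balanced)
  then have f: "(\<lambda>s. binary (census (balanced A) (length s))) =
      (\<lambda>x :: bool list. True # replicate (length x - 1) False)" by simp
  show ?thesis
    using * unfolding polytime_census_def polytime_computable_on_def computes_in_time_def f by blast
qed

text \<open>At the first difference \<open>w\<close> has 0 and the bound has 1, which places it
  within the blocks for \<open>x\<close>. Before it, \<open>w\<close> agrees with the bound and so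
  has no separator; hence the bit that \<open>flip\<close> changes lies beyond the first difference.
  The final zeros, of which there is at least one, guarantee this for the last bit too.\<close>

lemma val_flip_less:
  "length w = length (string_pair x (replicate (Suc p) False)) \<Longrightarrow>
    val w < val (string_pair x (replicate (Suc p) False)) \<Longrightarrow>
    val (flip w) < val (string_pair x (replicate (Suc p) False))"
proof (induction x arbitrary: w)
  case Nil
  then show ?case using val_replicate_False[of "Suc (Suc p)"] by simp
next
  case (Cons a x)
  let ?z = "string_pair x (replicate (Suc p) False)"
  obtain c d v where w: "w = c # d # v" and v: "length v = length ?z"
    using Cons.prems(1) by (cases w; cases "tl w") auto
  then have "v \<noteq> []" by auto
  show ?case
  proof (cases c)
    case True
    have lt: "val v < 2 ^ length ?z" "val (flip v) < 2 ^ length ?z"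
      and z: "val ?z < 2 ^ length ?z"
      using val_less[of v] val_less[of "flip v"] val_less[of ?z] v by simp_all
    have IH: "val v < val ?z \<Longrightarrow> val (flip v) < val ?z" using Cons.IH v by blast
    show ?thesis
      using Cons.prems(2) IH lt z v \<open>v \<noteq> []\<close> True w
      by (cases a; cases d) (simp_all add: flip_True del: length_string_pair, linarith?)
  next
    case False
    then have "flip w = False # (\<not> d) # v" using w by simp
    moreover have "val ((\<not> d) # v) < 2 ^ length ((\<not> d) # v)" by (rule val_less)
    ultimately show ?thesis using v by (simp del: length_string_pair)
  qed
qed

text \<open>Dividing values by \<open>2 ^ n\<close> isolates the first \<open>length u\<close> bits,
  and both ends of the interval give \<open>val u\<close>.\<close>

lemma val_interval:
  assumes "length w = length u + n"
    and "val (u @ replicate n False) \<le> val w" "val w \<le> val (u @ replicate n True)"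
  obtains y where "length y = n" "w = u @ y"
proof -
  define t y where "t = take (length u) w" and "y = drop (length u) w"
  have w: "w = t @ y" "length t = length u" "length y = n" using assms(1) by (auto simp: t_def y_def)
  have y: "val y < 2 ^ n" using val_less[of y] w by simp
  have "val u * 2 ^ n \<le> val t * 2 ^ n + val y" using assms(2) w by (simp add: val_append)
  also have "\<dots> < (val t + 1) * 2 ^ n" using y by simp
  finally have "val u < val t + 1" by (rule mult_right_less_imp_less) simp
  then have 1: "val u \<le> val t" by simp
  have "val t * 2 ^ n \<le> val t * 2 ^ n + val y" by simp
  also have "\<dots> \<le> val u * 2 ^ n + val (replicate n True)"
    using assms(3) w by (simp add: val_append)
  also have "\<dots> < (val u + 1) * 2 ^ n" using val_replicate_True[of n] by simp
  finally have "val t < val u + 1" by (rule mult_right_less_imp_less) simp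
  with 1 have "t = u" using val_inj[OF w(2)] by simp
  with w show thesis using that by blast
qed

text \<open>The rank is split at \<open>z\<close> = <x, 00...0>. The strings before \<open>z\<close>
  are handled by the involution. Those from \<open>z\<close> to \<open>q\<close> = <x, 01...1> are
  exactly the <x, 0y> with \<open>length y = p\<close>, and they are in \<open>balanced A\<close>
  iff <x, y> is in \<open>A\<close>.\<close>

lemma ranking_balanced:
  "ranking (balanced A) (string_pair x (False # replicate p True)) =
    val (True # string_pair x []) * 2 ^ p + card {y. length y = p \<and> string_pair x y \<in> A}"
proof -
  define u where "u = string_pair x [False]"
  define z where "z = u @ replicate p False"
  define q where "q = u @ replicate p True"
  define N where "N = val (True # z)"
  have q: "string_pair x (False # replicate p True) = q"
    using string_pair_append[of x "[False]" "replicate p True"] by (simp add: q_def u_def)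
  have z: "z = string_pair x (replicate (Suc p) False)"
    using string_pair_append[of x "[False]" "replicate p False"] by (simp add: z_def u_def)
  have len: "length z = length q" "length z = length u + p" by (simp_all add: z_def q_def)
  have "val (True # z) \<le> val (True # q)"
    using len by (simp add: z_def q_def val_append)
  then have Nq: "N \<le> val (True # q)" by (simp add: N_def)
  let ?low = "{y. val (True # y) < N \<and> y \<in> balanced A}"
  let ?high = "{y. N \<le> val (True # y) \<and> val (True # y) \<le> val (True # q) \<and> y \<in> balanced A}"
  have fin: "finite {y. val (True # y) < N \<and> Q y}" for Q
    by (rule finite_subset[OF _ finite_val_le[of N Q]]) (auto simp del: val.simps)
  have "{y. val (True # y) \<le> val (True # q) \<and> y \<in> balanced A} = ?low \<union> ?high"
    using Nq by (auto simp del: val.simps)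
  moreover have "finite ?high"
    by (rule finite_subset[OF _ finite_val_le[of "val (True # q)" "\<lambda>_. True"]])
      (auto simp del: val.simps)
  ultimately have "ranking (balanced A) q = card ?low + card ?high"
    unfolding ranking_val using fin by (simp only:) (intro card_Un_disjoint; auto simp del: val.simps)
  moreover have "card ?low = val (True # string_pair x []) * 2 ^ p"
  proof -
    let ?S = "{y. val (True # y) < N \<and> y \<noteq> []}"
    have "2 \<le> length z" by (simp add: z)
    then have N2: "2 \<le> N"
      using power_increasing[of 1 "length z" "2::nat"] by (simp add: N_def)
    have "flip y \<in> ?S" if "y \<in> ?S" for y
    proof -
      have y: "val (True # y) < val (True # z)" "y \<noteq> []" using that by (auto simp: N_def)
      have "val (True # flip y) < val (True # z)"
      proof (cases "length y = length z")
        case True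
        then show ?thesis using val_flip_less[of y x p] y by (simp add: z)
      next
        case False
        then have "length y < length z" using val_less_length[OF y(1)] by simp
        then show ?thesis using val_less_of_shorter[of "flip y" z] by simp
      qed
      then show ?thesis using y by (simp add: N_def)
    qed
    then have "2 * card (?S \<inter> balanced A) = card ?S"
      using fin by (intro card_balanced) auto
    also have "card ?S = card {y. val (True # y) < N \<and> val (True # y) \<noteq> val [True]}"
      unfolding val_True_inj ..
    also have "\<dots> = card {v. 0 < v \<and> v < N \<and> v \<noteq> val [True]}" by (rule card_val_True)
    also have "{v. 0 < v \<and> v < N \<and> v \<noteq> val [True]} = {2..<N}" by auto
    finally have S: "2 * card (?S \<inter> balanced A) = N - 2" by simp
    \<comment> \<open>There are \<open>N - 2\<close> nonempty strings before \<open>z\<close>. Half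
      of them together with the empty string are exactly half of \<open>N\<close>, and
      \<open>N\<close> is even because \<open>z\<close> ends in \<open>p + 1\<close> zeros.\<close>
    have "?low = insert [] (?S \<inter> balanced A)" using N2 by auto
    then have "card ?low = Suc (card (?S \<inter> balanced A))"
      using fin[of "\<lambda>y. y \<noteq> []"] by (simp add: card_insert_if)
    then have "2 * card ?low = N" using S N2 by simp
    moreover have "True # z = (True # string_pair x []) @ replicate (Suc p) False"
      using string_pair_append[of x "[]" "replicate (Suc p) False"] z by simp
    then have "N = val (True # string_pair x []) * 2 ^ Suc p"
      unfolding N_def by (simp only: val_append val_replicate_False length_replicate)
    ultimately show ?thesis by simp
  qed
  moreover have "card ?high = card {y. length y = p \<and> string_pair x y \<in> A}"
  proof -
    have mem: "u @ y \<in> balanced A \<longleftrightarrow> string_pair x y \<in> A" for y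
    proof -
      have "u @ y = string_pair x (False # y)"
        using string_pair_append[of x "[False]" y] by (simp add: u_def)
      then show ?thesis by (simp add: balanced_def)
    qed
    have "?high = (@) u ` {y. length y = p \<and> string_pair x y \<in> A}"
    proof (intro set_eqI iffI)
      fix w assume w: "w \<in> ?high"
      then have le: "val (True # z) \<le> val (True # w)" "val (True # w) \<le> val (True # q)"
        by (simp_all add: N_def)
      then have "length w = length z"
        using val_less_of_shorter[of w z] val_less_of_shorter[of q w] len by linarith
      then obtain y where "length y = p" "w = u @ y"
        using val_interval[of w u p] le len by (auto simp: z_def q_def)
      with w mem show "w \<in> (@) u ` {y. length y = p \<and> string_pair x y \<in> A}" by auto
    next
      fix w assume "w \<in> (@) u ` {y. length y = p \<and> string_pair x y \<in> A}"
      then obtain y where y: "w = u @ y" "length y = p" "string_pair x y \<in> A" by auto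
      then have "val y \<le> val (replicate p True)"
        using val_less[of y] val_replicate_True[of p] by simp
      then show "w \<in> ?high"
        using y mem len by (simp add: N_def z_def q_def val_append)
    qed
    then show ?thesis by (simp only:) (simp add: card_image inj_on_def)
  qed
  ultimately show ?thesis unfolding q by simp
qed

text \<open>
  The string \<open>\<langle>x, \<rangle>\<close> ends in 0, which absorbs the carry in case every \<open>y\<close> is a witness.
\<close>

lemma count_from_rank:
  assumes "c \<le> 2 ^ p"
  shows "cond (drop (length (string_pair x []))
      (binary (val (True # string_pair x []) * 2 ^ p + c))) False True
      (cond (tl (drop (length (string_pair x []))
        (binary (val (True # string_pair x []) * 2 ^ p + c)))) False True False) \<longleftrightarrow>
    2 ^ (p - 1) \<le> c"
proof -
  have "\<exists>u. string_pair x [] = u @ [False]" by (induction x) auto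
  then obtain u where u: "string_pair x [] = u @ [False]" by blast
  show ?thesis
  proof (cases "c < 2 ^ p")
    case True
    then obtain y where y: "length y = p" "val y = c" by (rule ex_val)
    have "val (True # u @ False # y) = val (True # u @ [False]) * 2 ^ p + c"
      using val_append[of "True # u @ [False]" y] y by simp
    then have "binary (val (True # string_pair x []) * 2 ^ p + c) = True # u @ False # y"
      using binary_val_True[of "u @ False # y"] by (simp only: u)
    then have d: "drop (length (string_pair x [])) (binary (val (True # string_pair x []) * 2 ^ p + c)) =
        False # y" by (simp only: u) simp
    show ?thesis
    proof (cases y)
      \<comment> \<open>Here \<open>p = 0\<close> and \<open>c = 0\<close>, below the truncated
        threshold \<open>2 ^ (0 - 1) = 1\<close>. This is why a missing second bit has to mean
        rejection.\<close>
      case Nil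
      then show ?thesis unfolding d using y by simp
    next
      case (Cons b v)
      then show ?thesis unfolding d using y val_less[of v] by (cases b) auto
    qed
  next
    case False
    then have c: "c = 2 ^ p" using assms by simp
    have "val (True # u @ True # replicate p False) = val (True # u @ [False]) * 2 ^ p + c"
      using val_append[of "True # u @ [True]" "replicate p False"] val_snoc[of "True # u"]
      by (simp add: c algebra_simps)
    then have "binary (val (True # string_pair x []) * 2 ^ p + c) = True # u @ True # replicate p False"
      using binary_val_True[of "u @ True # replicate p False"] by (simp only: u)
    then have d: "drop (length (string_pair x [])) (binary (val (True # string_pair x []) * 2 ^ p + c)) =
        True # replicate p False" by (simp only: u) simp
    show ?thesis unfolding d by (simp add: c)
  qed
qed

lemma PP_subset_P_of_rankable:
  assumes "\<And>A. A \<in> class_P \<Longrightarrow> polytime_census A \<Longrightarrow> rankable A"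
  shows "class_PP \<subseteq> class_P"
proof
  fix L assume "L \<in> class_PP"
  then obtain A p where A: "A \<in> class_P" and L: "\<And>x. x \<in> L \<longleftrightarrow>
      2 ^ (poly p (length x) - 1) \<le> card {y. length y = poly p (length x) \<and> string_pair x y \<in> A}"
    by (auto simp: class_PP_def)
  have "rankable (balanced A)"
    using assms balanced_in_P[OF A] polytime_census_balanced by blast
  then have rank: "polytime_computable_on UNIV (\<lambda>x. binary (ranking (balanced A) x))"
    by (simp add: rankable_def)
  let ?q = "\<lambda>x. string_pair x (False # replicate (poly p (length x)) True)"
  let ?r = "\<lambda>x. drop (length (string_pair x [])) (binary (ranking (balanced A) (?q x)))"
  have q: "feasible (\<lambda>e. ?q (e 0))"
    by (intro feasible_string_pair feasible_Cons feasible_clock feasible_var)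
  have r: "feasible (\<lambda>e. ?r (e 0))"
    by (rule feasible_drop[OF feasible_string_pair[OF feasible_var feasible_Nil]
          feasible_function[OF rank q]])
  let ?f = "\<lambda>e :: env. cond (?r (e 0)) [] [True] (tl (?r (e 0)))"
  have "feasible ?f"
    by (rule feasible_cond[OF r feasible_const feasible_const feasible_tl[OF r]])
  from feasible_imp_class_P[OF this] have "{x. cond (?f (arg x)) False True False} \<in> class_P" .
  also have "{x. cond (?f (arg x)) False True False} = L"
  proof (intro set_eqI)
    fix x
    let ?W = "{y. length y = poly p (length x) \<and> string_pair x y \<in> A}"
    have "card ?W \<le> card {y :: bool list. length y = poly p (length x)}"
      using finite_lists_length_eq[of "UNIV :: bool set"] by (intro card_mono) auto
    then have W: "card ?W \<le> 2 ^ poly p (length x)" by (simp add: card_length)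
    have "cond (?f (arg x)) False True False \<longleftrightarrow>
        cond (?r x) False True (cond (tl (?r x)) False True False)"
      by (simp add: cond_def split: list.split)
    also have "\<dots> \<longleftrightarrow> 2 ^ (poly p (length x) - 1) \<le> card ?W"
      unfolding ranking_balanced by (rule count_from_rank[OF W])
    finally show "x \<in> {x. cond (?f (arg x)) False True False} \<longleftrightarrow> x \<in> L"
      using L[of x] by simp
  qed
  finally show "L \<in> class_P" .
qed

theorem theorem3p2:
  "(\<forall>A. A \<in> class_P \<and> polytime_census A \<longrightarrow> rankable A) \<longleftrightarrow> class_P = class_PP"
  using PP_subset_P_of_rankable rankable_of_PP_subset_P class_P_subset_class_PP by blast

end
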